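(* Let $d\ge2$ and let $X=(X_1,\dots,X_d)$ be a random vector with components $X_j\in\mathbb{R}^{p_j}$. Let $$\mathcal{R}(X)=\sum_{c=1}^{d-1}\mathcal{V}^2((X_c,X_{c^+})),\qquad \mathcal{S}(X)=\sum_{c=1}^{d}\mathcal{V}^2((X_c,X_{-c})).$$ If $\mathrm{E}|X|<\infty$, then $\mathcal{R}(X),\mathcal{S}(X)\in[0,\infty)$; moreover $\mathcal{R}(X)=0$ if and only if $X_1,\dots,X_d$ are mutually independent, and $\mathcal{S}(X)=0$ if and only if $X_1,\dots,X_d$ are mutually independent.
   Context: Each component $X_j$ is a continuous random vector in $\mathbb{R}^{p_j}$ (its distribution is absolutely continuous with respect to Lebesgue measure). $|\cdot|$ is the Euclidean norm (modulus for complex numbers), $\langle\cdot,\cdot\rangle$ the Euclidean inner product. $X_{c^+}=(X_{c+1},\dots,X_d)$ for $c=0,\dots,d-1$; $X_{-c}=(X_1,\dots,X_{c-1},X_{c+1},\dots,X_d)$ for $c=1,\dots,d$. For a pair of random vectors $Y\in\mathbb{R}^a$, $Z\in\mathbb{R}^b$, the squared distance covariance is $$\mathcal{V}^2((Y,Z))=\int_{\mathbb{R}^{a+b}}|\phi_{(Y,Z)}(u,v)-\phi_Y(u)\phi_Z(v)|^2\,w_0(u,v)\,du\,dv,\qquad w_0(u,v)=\big(K_aK_b|u|^{a+1}|v|^{b+1}\big)^{-1},$$ where $u\in\mathbb{R}^a$, $v\in\mathbb{R}^b$, $\phi$ denotes characteristic functions ($\phi_Y(u)=\mathrm{E}[e^{i\langle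 u,Y\rangle}]$, etc.), and $K_q=\frac{\pi^{(q+1)/2}}{\Gamma((q+1)/2)}$. *)

theory Defs
  imports "HOL-Probability.Probability"
begin

text \<open>
  Dimensions vary within one statement here, so \<open>\<real>\<^sup>q\<close> is rendered as the functions
  \<open>I \<Rightarrow> \<real>\<close> on a finite index set \<open>I\<close> with \<open>card I = q\<close>, extensional outside \<open>I\<close>.
  Its Euclidean norm is \<^const>\<open>L2_set\<close>.
\<close>

definition lebesgue_on_index :: "'i set \<Rightarrow> ('i \<Rightarrow> real) measure" where
  "lebesgue_on_index I = Pi\<^sub>M I (\<lambda>_. lborel)"

definition inner_on :: "'i set \<Rightarrow> ('i \<Rightarrow> real) \<Rightarrow> ('i \<Rightarrow> real) \<Rightarrow> real" where
  "inner_on I u y = (\<Sum>i\<in>I. u i * y i)"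

definition char_fun :: "'w measure \<Rightarrow> 'i set \<Rightarrow> ('w \<Rightarrow> 'i \<Rightarrow> real) \<Rightarrow> ('i \<Rightarrow> real) \<Rightarrow> complex" where
  "char_fun M I Y u = (LINT w|M. exp (\<i> * complex_of_real (inner_on I u (Y w))))"

definition joint_char_fun ::
  "'w measure \<Rightarrow> 'i set \<Rightarrow> ('w \<Rightarrow> 'i \<Rightarrow> real) \<Rightarrow> 'j set \<Rightarrow> ('w \<Rightarrow> 'j \<Rightarrow> real) \<Rightarrow>
    ('i \<Rightarrow> real) \<Rightarrow> ('j \<Rightarrow> real) \<Rightarrow> complex" where
  "joint_char_fun M I Y J Z u v =
    (LINT w|M. exp (\<i> * complex_of_real (inner_on I u (Y w) + inner_on J v (Z w))))"

definition K_const :: "nat \<Rightarrow> real" where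
  "K_const q = pi powr ((real q + 1) / 2) / Gamma ((real q + 1) / 2)"

text \<open>
  Where \<open>u = 0\<close> or \<open>v = 0\<close> (a null set) the weight takes the value \<open>inverse 0 = 0\<close>.
\<close>

definition weight :: "'i set \<Rightarrow> 'j set \<Rightarrow> ('i \<Rightarrow> real) \<Rightarrow> ('j \<Rightarrow> real) \<Rightarrow> real" where
  "weight I J u v =
    inverse (K_const (card I) * K_const (card J) *
      L2_set u I ^ (card I + 1) * L2_set v J ^ (card J + 1))"

text \<open>
  The value lies in \<open>[0, \<infinity>]\<close>, so finiteness is not built into the definition.
\<close>

definition dcov_sq ::
  "'w measure \<Rightarrow> 'i set \<Rightarrow> ('w \<Rightarrow> 'i \<Rightarrow> real) \<Rightarrow> 'j set \<Rightarrow> ('w \<Rightarrow> 'j \<Rightarrow> real) \<Rightarrow> ennreal" where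
  "dcov_sq M I Y J Z =
    (\<integral>\<^sup>+ (u, v). ennreal
        ((cmod (joint_char_fun M I Y J Z u v - char_fun M I Y u * char_fun M J Z v))\<^sup>2
          * weight I J u v)
      \<partial>(lebesgue_on_index I \<Otimes>\<^sub>M lebesgue_on_index J))"

text \<open>
  The subvector \<open>(X\<^sub>j)\<close>, \<open>j \<in> A\<close>, is a single vector whose coordinates are indexed by
  pairs \<open>(j, k)\<close> with \<open>1 \<le> k \<le> p j\<close>.
\<close>

definition coords :: "(nat \<Rightarrow> nat) \<Rightarrow> nat set \<Rightarrow> (nat \<times> nat) set" where
  "coords p A = (SIGMA j:A. {1..p j})"

definition subvector ::
  "(nat \<Rightarrow> nat) \<Rightarrow> (nat \<Rightarrow> 'w \<Rightarrow> nat \<Rightarrow> real) \<Rightarrow> nat set \<Rightarrow> 'w \<Rightarrow> nat \<times> nat \<Rightarrow> real" where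
  "subvector p X A w = (\<lambda>(j, k)\<in>coords p A. X j w k)"

definition R_dep ::
  "'w measure \<Rightarrow> nat \<Rightarrow> (nat \<Rightarrow> nat) \<Rightarrow> (nat \<Rightarrow> 'w \<Rightarrow> nat \<Rightarrow> real) \<Rightarrow> ennreal" where
  "R_dep M d p X =
    (\<Sum>c = 1..d - 1.
      dcov_sq M {1..p c} (X c) (coords p {c + 1..d}) (subvector p X {c + 1..d}))"

definition S_dep ::
  "'w measure \<Rightarrow> nat \<Rightarrow> (nat \<Rightarrow> nat) \<Rightarrow> (nat \<Rightarrow> 'w \<Rightarrow> nat \<Rightarrow> real) \<Rightarrow> ennreal" where
  "S_dep M d p X =
    (\<Sum>c = 1..d.
      dcov_sq M {1..p c} (X c) (coords p ({1..d} - {c})) (subvector p X ({1..d} - {c})))"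

end

theory Submission
  imports Defs
begin

text \<open>
  Finiteness: \<open>\<phi>(u, v) - \<phi>\<^sub>Y(u) \<phi>\<^sub>Z(v)\<close> is the covariance of \<open>exp (i \<langle>u, Y\<rangle>) - 1\<close> and
  \<open>exp (i \<langle>v, Z\<rangle>) - 1\<close>, so by Cauchy--Schwarz its squared modulus is at most
  \<open>64 E[min 1 (|u| |Y|)\<^sup>2] E[min 1 (|v| |Z|)\<^sup>2]\<close>. By Tonelli the weighted integral factors, and splitting
  into dyadic shells gives \<open>\<integral> min 1 (r |u|)\<^sup>2 / |u|\<^bsup>a+1\<^esup> du \<le> C r\<close>.

  Independence: if the distance covariance vanishes, the joint characteristic function factors almost
  everywhere, hence everywhere by continuity. Multivariate uniqueness follows from Levy's
  one-dimensional theorem by turning one coordinate of the exponent after another into an indicator.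
  Finally \<open>X\<^sub>c\<close> being independent of \<open>(X\<^sub>c\<^sub>+\<^sub>1, \<dots>, X\<^sub>d)\<close> for every \<open>c < d\<close> gives mutual independence by
  downward induction on \<open>c\<close>.
\<close>

subsection \<open>Radial integrals\<close>

lemma sets_lebesgue_on_index: "sets (lebesgue_on_index I) = sets (Pi\<^sub>M I (\<lambda>_. borel))"
  unfolding lebesgue_on_index_def by (intro sets_PiM_cong) auto

lemma space_lebesgue_on_index: "space (lebesgue_on_index I) = extensional I"
  unfolding lebesgue_on_index_def by (simp add: space_PiM PiE_def)

lemma measurable_lebesgue_on_index_component [measurable (raw)]:
  assumes "f \<in> measurable M (lebesgue_on_index I)" "i \<in> I"
  shows "(\<lambda>x. f x i) \<in> borel_measurable M"
proof -
  have "f \<in> measurable M (Pi\<^sub>M I (\<lambda>_. borel))"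
    using assms(1) by (simp add: measurable_cong_sets[OF refl sets_lebesgue_on_index])
  then show ?thesis using assms(2) by measurable
qed

lemma sigma_finite_lebesgue_on_index: "finite I \<Longrightarrow> sigma_finite_measure (lebesgue_on_index I)"
  unfolding lebesgue_on_index_def
  by (intro product_sigma_finite.sigma_finite) (auto intro: product_sigma_finite.intro sigma_finite_lborel)

lemma emeasure_lebesgue_on_index_PiE:
  assumes "finite I" "\<And>i. i \<in> I \<Longrightarrow> B i \<in> sets borel"
  shows "emeasure (lebesgue_on_index I) (Pi\<^sub>E I B) = (\<Prod>i\<in>I. emeasure lborel (B i))"
  unfolding lebesgue_on_index_def
  using assms by (intro product_sigma_finite.emeasure_PiM) (auto intro: product_sigma_finite.intro sigma_finite_lborel)

lemma PiE_in_sets_lebesgue_on_index: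
  assumes "finite I" "\<And>i. i \<in> I \<Longrightarrow> B i \<in> sets borel"
  shows "Pi\<^sub>E I B \<in> sets (lebesgue_on_index I)"
  unfolding lebesgue_on_index_def using assms by (intro sets_PiM_I_finite) auto

lemma measurable_L2_set [measurable (raw)]:
  assumes "f \<in> measurable M (lebesgue_on_index I)"
  shows "(\<lambda>x. L2_set (f x) I) \<in> borel_measurable M"
  unfolding L2_set_def using assms
  by (intro borel_measurable_sqrt[THEN measurable_compose[rotated]] borel_measurable_sum borel_measurable_power measurable_lebesgue_on_index_component)

lemma measurable_inner_on [measurable (raw)]:
  assumes "f \<in> measurable M (lebesgue_on_index I)" "g \<in> measurable M (lebesgue_on_index I)"
  shows "(\<lambda>x. inner_on I (f x) (g x)) \<in> borel_measurable M"
  unfolding inner_on_def using assms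
  by (intro borel_measurable_sum borel_measurable_times measurable_lebesgue_on_index_component)

text \<open>The ball lies in the cube of side \<open>2 * s\<close>. Only the order
  \<open>s ^ card I\<close> matters later, so the sharp volume constant is given up.\<close>

lemma emeasure_L2_ball_le:
  assumes "finite I" "s \<ge> 0"
  shows "emeasure (lebesgue_on_index I) {u \<in> space (lebesgue_on_index I). L2_set u I \<le> s} \<le> ennreal ((2 * s) ^ card I)"
proof -
  have "emeasure (lebesgue_on_index I) {u \<in> space (lebesgue_on_index I). L2_set u I \<le> s}
      \<le> emeasure (lebesgue_on_index I) (Pi\<^sub>E I (\<lambda>_. {-s..s}))"
  proof (intro emeasure_mono PiE_in_sets_lebesgue_on_index assms subsetI)
    fix u assume u: "u \<in> {u \<in> space (lebesgue_on_index I). L2_set u I \<le> s}"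
    have "\<bar>u i\<bar> \<le> s" if "i \<in> I" for i
      using member_le_L2_set[OF \<open>finite I\<close> that, of "\<lambda>i. \<bar>u i\<bar>"] u by (simp add: L2_set_def)
    with u show "u \<in> Pi\<^sub>E I (\<lambda>_. {-s..s})"
      by (force simp: space_lebesgue_on_index PiE_iff)
  qed simp
  also have "\<dots> = (\<Prod>i\<in>I. emeasure lborel {-s..s})"
    using assms by (intro emeasure_lebesgue_on_index_PiE) auto
  also have "\<dots> = ennreal ((2 * s) ^ card I)"
    using assms by (simp add: ennreal_power)
  finally show ?thesis .
qed

lemma abs_inner_on_le: "\<bar>inner_on I u y\<bar> \<le> L2_set u I * L2_set y I"
proof -
  have "\<bar>inner_on I u y\<bar> \<le> (\<Sum>i\<in>I. \<bar>u i\<bar> * \<bar>y i\<bar>)"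
    unfolding inner_on_def by (intro order_trans[OF sum_abs]) (simp add: abs_mult)
  then show ?thesis using L2_set_mult_ineq[of u y I] by linarith
qed

section \<open>Dyadic estimate of the radial integral\<close>

lemma dyadic_bracket:
  fixes q :: real
  assumes "1 \<le> q"
  obtains k :: nat where "2 ^ k \<le> q" "q \<le> 2 ^ (k + 1)"
proof
  define k where "k = nat \<lfloor>log 2 q\<rfloor>"
  have "log 2 q \<ge> 0" using assms by simp
  then have "2 powr (real k) \<le> q" "q \<le> 2 powr (real (k + 1))"
    using assms by (simp_all add: k_def powr_le_iff le_powr_iff) linarith+
  then show "2 ^ k \<le> q" "q \<le> 2 ^ (k + 1)"
    by (simp_all only: powr_realpow zero_less_numeral)
qed

text \<open>
  Dyadic shells around radius \<open>1 / r\<close>: the shell \<open>2\<^sup>k \<le> r s < 2\<^sup>k\<^sup>+\<^sup>1\<close> with \<open>k \<ge> 0\<close> is covered by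
  the \<open>k\<close>-th outer ball, the one with \<open>2\<^sup>-\<^sup>k\<^sup>-\<^sup>1 \<le> r s < 2\<^sup>-\<^sup>k\<close> by the \<open>k\<close>-th inner ball.
\<close>

lemma dyadic_bound:
  fixes r s :: real
  assumes r: "r > 0" and s: "s \<ge> 0"
  shows "ennreal (min 1 ((r * s)\<^sup>2) * inverse (s ^ (a + 1))) \<le>
    (\<Sum>k. ennreal ((r / 2 ^ k) ^ (a + 1)) * indicator {..2 ^ (k + 1) / r} s) +
    (\<Sum>k. ennreal (4 * (r * 2 ^ (k + 1)) ^ (a + 1) / 4 ^ (k + 1)) * indicator {..1 / (r * 2 ^ k)} s)"
    (is "?L \<le> (\<Sum>k. ?A k) + (\<Sum>k. ?B k)")
proof -
  have le_suminf: "f k \<le> (\<Sum>k. f k)" for f :: "nat \<Rightarrow> ennreal" and k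
    using sum_le_suminf[of f "{k}"] by (simp add: summableI)
  consider "s = 0" | "s > 0" "r * s \<ge> 1" | "s > 0" "r * s < 1" using s by linarith
  then show ?thesis
  proof cases
    case 1
    \<comment> \<open>At the origin the weight is \<open>inverse 0 = 0\<close>, so the left side
      vanishes.\<close>
    then show ?thesis by simp
  next
    case 2
    obtain k where "2 ^ k \<le> r * s" "r * s \<le> 2 ^ (k + 1)"
      using dyadic_bracket[OF 2(2)] by blast
    then have "s \<le> 2 ^ (k + 1) / r" "inverse s \<le> r / 2 ^ k"
      using r 2 by (simp_all add: field_simps)
    have "min 1 ((r * s)\<^sup>2) * inverse (s ^ (a + 1)) \<le> 1 * (r / 2 ^ k) ^ (a + 1)"
      using \<open>inverse s \<le> r / 2 ^ k\<close> 2 unfolding power_inverse[symmetric]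
      by (intro mult_mono power_mono) auto
    then have "?L \<le> ?A k"
      using \<open>s \<le> 2 ^ (k + 1) / r\<close> by (simp add: ennreal_leI)
    also have "\<dots> \<le> (\<Sum>k. ?A k)" by (rule le_suminf)
    finally show ?thesis by (simp add: add_increasing2)
  next
    case 3
    have "1 \<le> 1 / (r * s)" using 3 r by simp
    then obtain k where "2 ^ k \<le> 1 / (r * s)" "1 / (r * s) \<le> 2 ^ (k + 1)"
      using dyadic_bracket by blast
    then have "s \<le> 1 / (r * 2 ^ k)" "inverse s \<le> r * 2 ^ (k + 1)" "r * s \<le> 1 / 2 ^ k"
      using r 3 by (simp_all add: field_simps)
    \<comment> \<open>The factor \<open>(1 / 2 ^ k)\<^sup>2\<close> from the minimum makes the inner
      shells summable: weight times ball volume alone grows like \<open>2 ^ k\<close>.\<close>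
    have "min 1 ((r * s)\<^sup>2) * inverse (s ^ (a + 1)) \<le> (1 / 2 ^ k)\<^sup>2 * (r * 2 ^ (k + 1)) ^ (a + 1)"
      using \<open>inverse s \<le> r * 2 ^ (k + 1)\<close> \<open>r * s \<le> 1 / 2 ^ k\<close> 3 r unfolding power_inverse[symmetric]
      by (intro mult_mono power_mono min.coboundedI2) auto
    also have "(1 / 2 ^ k)\<^sup>2 = (4 / 4 ^ (k + 1) :: real)"
      by (simp add: power_divide flip: power_mult_distrib power2_eq_square) (simp add: power2_eq_square flip: power_mult_distrib)
    also have "4 / 4 ^ (k + 1) * (r * 2 ^ (k + 1)) ^ (a + 1) = 4 * (r * 2 ^ (k + 1)) ^ (a + 1) / 4 ^ (k + 1)"
      by (rule times_divide_eq_left)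
    finally have "?L \<le> ennreal (4 * (r * 2 ^ (k + 1)) ^ (a + 1) / 4 ^ (k + 1))"
      by (rule ennreal_leI)
    also have "\<dots> = ?B k"
      using \<open>s \<le> 1 / (r * 2 ^ k)\<close> by (simp add: indicator_def)
    also have "\<dots> \<le> (\<Sum>k. ?B k)" by (rule le_suminf)
    finally show ?thesis by (simp add: add_increasing)
  qed
qed

text \<open>The weight exponent exceeds the dimension by one, so shell bound times ball volume
  leaves one power of \<open>r\<close>: the \<open>k\<close>-th outer term is
  \<open>4 ^ card I * r / 2 ^ k\<close> and the \<open>k\<close>-th inner term twice that. The two
  geometric series add up to \<open>6 * 4 ^ card I * r\<close>. Linearity in \<open>r\<close> is
  what lets a first moment suffice.\<close>

lemma radial_integral_le:
  assumes "finite I" "r \<ge> 0"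
  shows "(\<integral>\<^sup>+u. ennreal (min 1 ((r * L2_set u I)\<^sup>2) * inverse (L2_set u I ^ (card I + 1))) \<partial>lebesgue_on_index I)
    \<le> ennreal (10 * 4 ^ card I * r)"
proof (cases "r = 0")
  case False
  with assms have r: "r > 0" by simp
  let ?L = "lebesgue_on_index I" and ?a = "card I"
  have ball: "(\<integral>\<^sup>+u. ennreal c * indicator {..s} (L2_set u I) \<partial>?L) \<le> ennreal (c * (2 * s) ^ ?a)"
    if "c \<ge> 0" "s \<ge> 0" for c s
  proof -
    have "(\<integral>\<^sup>+u. ennreal c * indicator {..s} (L2_set u I) \<partial>?L) =
       ennreal c * (\<integral>\<^sup>+u. indicator {u \<in> space ?L. L2_set u I \<le> s} u \<partial>?L)"
      by (subst nn_integral_cmult[symmetric]) (auto intro!: nn_integral_cong simp: indicator_def)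
    also have "\<dots> \<le> ennreal c * ennreal ((2 * s) ^ ?a)"
      using emeasure_L2_ball_le[OF \<open>finite I\<close> \<open>s \<ge> 0\<close>] by (subst nn_integral_indicator) (auto intro: mult_left_mono)
    finally show ?thesis using that by (simp add: ennreal_mult)
  qed
  have "(\<integral>\<^sup>+u. ennreal (min 1 ((r * L2_set u I)\<^sup>2) * inverse (L2_set u I ^ (?a + 1))) \<partial>?L) \<le>
    (\<integral>\<^sup>+u. (\<Sum>k. ennreal ((r / 2 ^ k) ^ (?a + 1)) * indicator {..2 ^ (k + 1) / r} (L2_set u I)) +
    (\<Sum>k. ennreal (4 * (r * 2 ^ (k + 1)) ^ (?a + 1) / 4 ^ (k + 1)) * indicator {..1 / (r * 2 ^ k)} (L2_set u I)) \<partial>?L)"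
    by (intro nn_integral_mono dyadic_bound r) simp
  also have "\<dots> = (\<Sum>k. \<integral>\<^sup>+u. ennreal ((r / 2 ^ k) ^ (?a + 1)) * indicator {..2 ^ (k + 1) / r} (L2_set u I) \<partial>?L) +
    (\<Sum>k. \<integral>\<^sup>+u. ennreal (4 * (r * 2 ^ (k + 1)) ^ (?a + 1) / 4 ^ (k + 1)) * indicator {..1 / (r * 2 ^ k)} (L2_set u I) \<partial>?L)"
    by (simp add: nn_integral_add nn_integral_suminf)
  also have "\<dots> \<le> (\<Sum>k. ennreal ((r / 2 ^ k) ^ (?a + 1) * (2 * (2 ^ (k + 1) / r)) ^ ?a)) +
    (\<Sum>k. ennreal (4 * (r * 2 ^ (k + 1)) ^ (?a + 1) / 4 ^ (k + 1) * (2 * (1 / (r * 2 ^ k))) ^ ?a))"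
    using r by (intro add_mono suminf_le ball summableI) auto
  also have "\<dots> = (\<Sum>k. ennreal (4 ^ ?a * r * (1 / 2) ^ k)) + (\<Sum>k. ennreal (2 * 4 ^ ?a * r * (1 / 2) ^ k))"
  proof -
    \<comment> \<open>Pairing the powers with exponent \<open>card I\<close> turns weight base times
      cube side into the constant 4, with one factor \<open>p\<close> left over.\<close>
    have pw: "4 * p ^ (?a + 1) / D * q ^ ?a = 4 * (p * q) ^ ?a * p / D" for p q D :: real
      by (simp add: power_mult_distrib)
    have "(r / 2 ^ k) ^ (?a + 1) * (2 * (2 ^ (k + 1) / r)) ^ ?a = 4 ^ ?a * r * (1 / 2) ^ k" for k
    proof -
      have "(r / 2 ^ k) ^ (?a + 1) * (2 * (2 ^ (k + 1) / r)) ^ ?a = ((r / 2 ^ k) * (2 * (2 ^ (k + 1) / r))) ^ ?a * (r / 2 ^ k)"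
        by (simp only: power_mult_distrib power_add power_one_right mult_ac)
      also have "(r / 2 ^ k) * (2 * (2 ^ (k + 1) / r)) = 4" using r by simp
      finally show ?thesis by (simp add: power_one_over field_simps)
    qed
    moreover have "4 * (r * 2 ^ (k + 1)) ^ (?a + 1) / 4 ^ (k + 1) * (2 * (1 / (r * 2 ^ k))) ^ ?a = 2 * 4 ^ ?a * r * (1 / 2) ^ k" for k
    proof -
      have "4 * (r * 2 ^ (k + 1)) ^ (?a + 1) / 4 ^ (k + 1) * (2 * (1 / (r * 2 ^ k))) ^ ?a =
         4 * ((r * 2 ^ (k + 1)) * (2 * (1 / (r * 2 ^ k)))) ^ ?a * (r * 2 ^ (k + 1)) / 4 ^ (k + 1)"
        using pw[of "r * 2 ^ (k + 1)"] by blast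
      also have "(r * 2 ^ (k + 1)) * (2 * (1 / (r * 2 ^ k))) = 4" using r by simp
      finally have eq: "4 * (r * 2 ^ (k + 1)) ^ (?a + 1) / 4 ^ (k + 1) * (2 * (1 / (r * 2 ^ k))) ^ ?a =
        4 * 4 ^ ?a * (r * 2 ^ (k + 1)) / 4 ^ (k + 1)" .
      have "(4::real) ^ (k + 1) = 2 ^ (k + 1) * 2 ^ (k + 1)" by (simp flip: power_mult_distrib)
      then show ?thesis unfolding eq by (simp only:) (simp add: power_one_over field_simps)
    qed
    ultimately show ?thesis by (simp only:)
  qed
  also have "\<dots> = ennreal (4 ^ ?a * r * 2) + ennreal (2 * 4 ^ ?a * r * 2)"
  proof -
    have sum: "(\<Sum>k. ennreal (c * (1 / 2) ^ k)) = ennreal (c * 2)" if "c \<ge> 0" for c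
    proof (rule suminf_ennreal_eq)
      show "(\<lambda>k. c * (1 / 2) ^ k) sums (c * 2)"
        using sums_mult[OF geometric_sums[of "1/2 :: real"], of c] by simp
    qed (use that in simp)
    show ?thesis by (intro arg_cong2[where f = "(+)"] sum) (use r in simp_all)
  qed
  also have "\<dots> = ennreal (4 ^ ?a * r * 2 + 2 * 4 ^ ?a * r * 2)"
    using r by (intro ennreal_plus[symmetric]) auto
  also have "\<dots> \<le> ennreal (10 * 4 ^ ?a * r)"
    using r by (intro ennreal_leI) auto
  finally show ?thesis .
qed simp

subsection \<open>Uniqueness of multivariate characteristic functions\<close>

text \<open>Dividing \<open>w\<close> by its mass gives a probability density, so integrals weighted
  by \<open>w\<close> become statements about a law on the line, to which Levy's theorem
  applies.\<close>

lemma weighted_distr: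
  fixes \<xi> w :: "'a \<Rightarrow> real"
  assumes [measurable]: "\<xi> \<in> borel_measurable M" and w: "integrable M w"
    and w0: "\<And>x. 0 \<le> w x" and c: "integral\<^sup>L M w = c" "c > 0"
  defines "P \<equiv> distr (density M (\<lambda>x. w x / c)) borel \<xi>"
  shows "real_distribution P"
    and "char P t = (LINT x|M. w x *\<^sub>R iexp (t * \<xi> x)) /\<^sub>R c"
    and "A \<in> sets borel \<Longrightarrow> measure P A = (LINT x|M. w x * indicator A (\<xi> x)) / c"
proof -
  have [measurable]: "w \<in> borel_measurable M" using w by auto
  have "emeasure (density M (\<lambda>x. w x / c)) (space M) = (\<integral>\<^sup>+x. ennreal (w x / c) \<partial>M)"
    by (subst emeasure_density) (auto intro!: nn_integral_cong)
  also have "\<dots> = ennreal (LINT x|M. w x / c)"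
    using w0 c w by (intro nn_integral_eq_integral) auto
  also have "\<dots> = 1" using c by simp
  finally interpret D: prob_space "density M (\<lambda>x. w x / c)"
    by (intro prob_spaceI) simp
  show "real_distribution P"
    unfolding P_def by (rule D.real_distribution_distr) simp
  have "char P t = (LINT x|M. (w x / c) *\<^sub>R iexp (t * \<xi> x))"
    unfolding P_def char_def using w0 c
    by (subst integral_distr, simp, simp) (subst integral_density, auto)
  also have "\<dots> = (LINT x|M. (1 / c) *\<^sub>R (w x *\<^sub>R iexp (t * \<xi> x)))"
    by (simp add: divide_inverse_commute)
  finally show "char P t = (LINT x|M. w x *\<^sub>R iexp (t * \<xi> x)) /\<^sub>R c"
    by (simp only: integral_scaleR_right) (simp add: divide_inverse_commute)
  assume A[measurable]: "A \<in> sets borel"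
  have "measure P A = integral\<^sup>L P (indicator A)"
    using A by (simp add: P_def)
  also have "\<dots> = (LINT x|density M (\<lambda>x. w x / c). indicator A (\<xi> x))"
    unfolding P_def by (subst integral_distr) simp_all
  also have "\<dots> = (LINT x|M. (w x / c) *\<^sub>R indicator A (\<xi> x))"
    using w0 c by (subst integral_density) auto
  finally show "measure P A = (LINT x|M. w x * indicator A (\<xi> x)) / c"
    by simp
qed

text \<open>The transforms at \<open>t = 0\<close> give equal masses. Mass zero makes both weights
  vanish almost everywhere; positive mass can be normalised, which reduces the claim to Levy's
  theorem.\<close>

lemma weighted_char_uniqueness:
  fixes \<xi> w :: "'a \<Rightarrow> real" and \<eta> v :: "'b \<Rightarrow> real"
  assumes \<xi>: "\<xi> \<in> borel_measurable M" and \<eta>: "\<eta> \<in> borel_measurable N"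
    and w: "integrable M w" "\<And>x. 0 \<le> w x" and v: "integrable N v" "\<And>y. 0 \<le> v y"
    and eq: "\<And>t. (LINT x|M. w x *\<^sub>R iexp (t * \<xi> x)) = (LINT y|N. v y *\<^sub>R iexp (t * \<eta> y))"
    and A: "A \<in> sets borel"
  shows "(LINT x|M. w x * indicator A (\<xi> x)) = (LINT y|N. v y * indicator A (\<eta> y))"
proof -
  define c where "c = integral\<^sup>L M w"
  have "complex_of_real (integral\<^sup>L M w) = complex_of_real (integral\<^sup>L N v)"
    using eq[of 0] by (simp add: scaleR_conv_of_real)
  then have cM: "integral\<^sup>L M w = c" and cN: "integral\<^sup>L N v = c"
    unfolding c_def by (simp_all only: of_real_eq_iff)
  have "c \<ge> 0" using w cM by (metis Bochner_Integration.integral_nonneg)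
  show ?thesis
  proof (cases "c = 0")
    case True
    have "AE x in M. w x = 0" "AE y in N. v y = 0"
      using True cM cN w v by (simp_all flip: integral_nonneg_eq_0_iff_AE)
    then have "(LINT x|M. w x * indicator A (\<xi> x)) = 0" "(LINT y|N. v y * indicator A (\<eta> y)) = 0"
      by (auto intro!: integral_eq_zero_AE)
    then show ?thesis by simp
  next
    case False
    with \<open>c \<ge> 0\<close> have "c > 0" by simp
    note M = weighted_distr[OF \<xi> w cM this] and N = weighted_distr[OF \<eta> v cN this]
    have "distr (density M (\<lambda>x. w x / c)) borel \<xi> = distr (density N (\<lambda>x. v x / c)) borel \<eta>"
      by (intro Levy_uniqueness M(1) N(1) ext) (simp only: M(2) N(2) eq)
    then show ?thesis
      using M(3)[OF A] N(3)[OF A] False by simp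
  qed
qed

section \<open>Exchanging exponentials for indicators\<close>

text \<open>Interpolates between the joint characteristic function (\<open>J = {}\<close>) and the
  probability of a rectangle (\<open>I = {}\<close>): coordinates in \<open>J\<close> have become
  indicators, those in \<open>I\<close> still sit in the exponent.\<close>

definition cylinder_char ::
  "'a measure \<Rightarrow> 'i set \<Rightarrow> ('i \<Rightarrow> real set) \<Rightarrow> 'i set \<Rightarrow> ('i \<Rightarrow> real) \<Rightarrow> ('i \<Rightarrow> 'a \<Rightarrow> real) \<Rightarrow> complex" where
  "cylinder_char M J A I u \<xi> =
    (LINT x|M. (\<Prod>i\<in>J. indicator (A i) (\<xi> i x) :: real) *\<^sub>R iexp (\<Sum>i\<in>I. u i * \<xi> i x))"

text \<open>
  The weights \<open>W \<theta>\<close> are nonnegative, so the one-dimensional uniqueness theorem applies to the laws of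
  \<open>\<xi> i\<close> weighted by them, and \<open>\<theta> = 0, \<pi>, - \<pi> / 2\<close> suffice to recover \<open>cos\<close> and \<open>sin\<close> of the exponent.
\<close>

lemma cylinder_char_step:
  fixes \<xi> :: "'i \<Rightarrow> 'a \<Rightarrow> real" and u :: "'i \<Rightarrow> real"
  assumes "prob_space M" and I: "finite J" "finite I" "i \<notin> I"
    and \<xi>: "\<And>k. k \<in> insert i (J \<union> I) \<Longrightarrow> \<xi> k \<in> borel_measurable M"
    and A: "\<And>k. k \<in> insert i J \<Longrightarrow> A k \<in> sets borel"
  defines "f \<equiv> \<lambda>x. \<Prod>k\<in>J. indicator (A k) (\<xi> k x) :: real"
  defines "g \<equiv> \<lambda>x. \<Sum>k\<in>I. u k * \<xi> k x"
  defines "W \<equiv> \<lambda>\<theta> x. f x * (1 + cos (g x + \<theta>))"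
  shows "integrable M (W \<theta>)" (is ?int)
    and "0 \<le> W \<theta> x"
    and "(LINT x|M. W \<theta> x *\<^sub>R iexp (t * \<xi> i x)) =
      cylinder_char M J A (insert i I) ((\<lambda>_. 0)(i := t)) \<xi> +
      (iexp \<theta> * cylinder_char M J A (insert i I) (u(i := t)) \<xi> +
       iexp (- \<theta>) * cylinder_char M J A (insert i I) ((\<lambda>k. - u k)(i := t)) \<xi>) / 2"
    and "i \<notin> J \<Longrightarrow> cylinder_char M (insert i J) A I u \<xi> =
      Complex (((LINT x|M. W 0 x * indicator (A i) (\<xi> i x)) - (LINT x|M. W pi x * indicator (A i) (\<xi> i x))) / 2)
              ((LINT x|M. W (- pi / 2) x * indicator (A i) (\<xi> i x)) -
               (LINT x|M. W 0 x * indicator (A i) (\<xi> i x)) / 2 - (LINT x|M. W pi x * indicator (A i) (\<xi> i x)) / 2)"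
proof -
  interpret prob_space M by fact
  have [measurable]: "f \<in> borel_measurable M" "g \<in> borel_measurable M" "\<xi> i \<in> borel_measurable M"
    "A i \<in> sets borel"
    unfolding f_def g_def
    using \<xi> A by (auto intro!: borel_measurable_prod borel_measurable_sum borel_measurable_times measurable_compose[OF _ borel_measurable_indicator])
  have f: "0 \<le> f x" "f x \<le> 1" for x
    unfolding f_def by (auto intro!: prod_nonneg prod_le_1)
  have cos1: "0 \<le> 1 + cos t" "1 + cos t \<le> 2" for t :: real
    using cos_ge_minus_one[of t] cos_le_one[of t] by linarith+
  show "0 \<le> W \<theta> x" for \<theta> x
    unfolding W_def by (intro mult_nonneg_nonneg f cos1)
  have W2: "\<bar>W \<theta> x\<bar> \<le> 1 * 2" for \<theta> x
    unfolding W_def abs_mult using f[of x] cos1[of "g x + \<theta>"] by (intro mult_mono) auto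
  have Wm[measurable]: "W \<theta> \<in> borel_measurable M" for \<theta> unfolding W_def by measurable
  show "integrable M (W \<theta>)" for \<theta>
    by (rule integrable_const_bound[of _ 2]) (use W2 in auto)
  have cyl: "cylinder_char M J A (insert i I) (u'(i := t)) \<xi> =
      (LINT x|M. f x *\<^sub>R iexp (t * \<xi> i x + (\<Sum>k\<in>I. u' k * \<xi> k x)))" for u' t
  proof -
    have "(\<Sum>k\<in>insert i I. (u'(i := t)) k * \<xi> k x) = t * \<xi> i x + (\<Sum>k\<in>I. u' k * \<xi> k x)" for x
      using I by (subst sum.insert) (auto intro!: sum.cong)
    then show ?thesis unfolding cylinder_char_def f_def by simp
  qed
  have int: "integrable M (\<lambda>x. f x *\<^sub>R iexp (h x))" if [measurable]: "h \<in> borel_measurable M" for h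
    by (rule integrable_const_bound[of _ 1]) (use f in auto)
  \<comment> \<open>Splitting \<open>cos (g x + \<theta>)\<close> into two exponentials turns the
    weighted transform into three plain ones, with exponents \<open>0\<close>, \<open>u\<close> and
    \<open>- u\<close> on \<open>I\<close> and \<open>t\<close> at \<open>i\<close>.\<close>
  have "W \<theta> x *\<^sub>R iexp (t * \<xi> i x) = f x *\<^sub>R iexp (t * \<xi> i x) +
     (iexp \<theta> * f x *\<^sub>R iexp (t * \<xi> i x + g x) + iexp (- \<theta>) * f x *\<^sub>R iexp (t * \<xi> i x + (\<Sum>k\<in>I. - u k * \<xi> k x))) / 2" for x
  proof -
    have "(\<Sum>k\<in>I. - u k * \<xi> k x) = - g x" by (simp add: g_def sum_negf)
    then have e2: "iexp (t * \<xi> i x + (\<Sum>k\<in>I. - u k * \<xi> k x)) = iexp (t * \<xi> i x) * iexp (- g x)"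
      by (simp add: exp_add[symmetric] algebra_simps)
    have e1: "iexp (t * \<xi> i x + g x) = iexp (t * \<xi> i x) * iexp (g x)"
      by (simp add: exp_add[symmetric] algebra_simps)
    have c: "complex_of_real (cos (g x + \<theta>)) = (iexp (g x) * iexp \<theta> + iexp (- g x) * iexp (- \<theta>)) / 2"
      by (simp add: cos_of_real[symmetric] cos_exp_eq exp_add[symmetric] algebra_simps)
    define p where "p = iexp (t * \<xi> i x)"
    show ?thesis
      unfolding e1 e2 W_def p_def[symmetric] scaleR_conv_of_real
      unfolding of_real_mult of_real_add c
      by (simp add: algebra_simps add_divide_distrib)
  qed
  then have "(LINT x|M. W \<theta> x *\<^sub>R iexp (t * \<xi> i x)) = (LINT x|M. f x *\<^sub>R iexp (t * \<xi> i x) +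
     (iexp \<theta> * f x *\<^sub>R iexp (t * \<xi> i x + g x) + iexp (- \<theta>) * f x *\<^sub>R iexp (t * \<xi> i x + (\<Sum>k\<in>I. - u k * \<xi> k x))) / 2)"
    by simp
  also have "\<dots> = (LINT x|M. f x *\<^sub>R iexp (t * \<xi> i x)) +
     (iexp \<theta> * (LINT x|M. f x *\<^sub>R iexp (t * \<xi> i x + g x)) + iexp (- \<theta>) * (LINT x|M. f x *\<^sub>R iexp (t * \<xi> i x + (\<Sum>k\<in>I. - u k * \<xi> k x)))) / 2"
  proof -
    have [measurable]: "\<xi> k \<in> borel_measurable M" if "k \<in> I" for k
      using \<xi> that by auto
    have lin: "(LINT x|M. h1 x + (a * h2 x + b * h3 x) / 2) = integral\<^sup>L M h1 + (a * integral\<^sup>L M h2 + b * integral\<^sup>L M h3) / 2"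
      if "integrable M h1" "integrable M h2" "integrable M h3" for h1 h2 h3 :: "'a \<Rightarrow> complex" and a b
      using that by simp
    show ?thesis
      by (intro lin int; measurable)
  qed
  finally show "(LINT x|M. W \<theta> x *\<^sub>R iexp (t * \<xi> i x)) =
      cylinder_char M J A (insert i I) ((\<lambda>_. 0)(i := t)) \<xi> +
      (iexp \<theta> * cylinder_char M J A (insert i I) (u(i := t)) \<xi> +
       iexp (- \<theta>) * cylinder_char M J A (insert i I) ((\<lambda>k. - u k)(i := t)) \<xi>) / 2"
    unfolding cyl g_def by simp
  assume "i \<notin> J"
  let ?F = "\<lambda>x. f x * indicator (A i) (\<xi> i x) :: real"
  have intW: "integrable M (\<lambda>x. W \<theta> x * indicator (A i) (\<xi> i x))" for \<theta>
  proof (rule integrable_const_bound[of _ 2])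
    show "AE x in M. norm (W \<theta> x * indicator (A i) (\<xi> i x)) \<le> 2"
      using W2[of \<theta>] by (auto simp: indicator_def)
  qed simp
  have intF: "integrable M (\<lambda>x. ?F x *\<^sub>R iexp (g x))"
    by (rule integrable_const_bound[of _ 1]) (use f in \<open>auto simp: indicator_def\<close>)
  \<comment> \<open>\<open>W 0 - W pi\<close> cancels the constant 1 and leaves twice the cosine.
    For the imaginary part, \<open>cos (g - pi / 2) = sin g\<close>, and the mean of
    \<open>W 0\<close> and \<open>W pi\<close> is the term \<open>f\<close> to be removed.\<close>
  have Re: "Re (?F x *\<^sub>R iexp (g x)) = (W 0 x - W pi x) / 2 * indicator (A i) (\<xi> i x)" for x
    by (simp add: W_def Re_exp algebra_simps add_divide_distrib diff_divide_distrib)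
  have Im: "Im (?F x *\<^sub>R iexp (g x)) = (W (- pi / 2) x - W 0 x / 2 - W pi x / 2) * indicator (A i) (\<xi> i x)" for x
    by (simp add: W_def Im_exp cos_add algebra_simps add_divide_distrib diff_divide_distrib)
  have "cylinder_char M (insert i J) A I u \<xi> = (LINT x|M. ?F x *\<^sub>R iexp (g x))"
    unfolding cylinder_char_def f_def g_def using \<open>i \<notin> J\<close> I by (simp add: mult.commute)
  also have "\<dots> = Complex (LINT x|M. Re (?F x *\<^sub>R iexp (g x))) (LINT x|M. Im (?F x *\<^sub>R iexp (g x)))"
    unfolding integral_Re[OF intF] integral_Im[OF intF] by simp
  also have "(LINT x|M. Re (?F x *\<^sub>R iexp (g x))) =
     (LINT x|M. (W 0 x * indicator (A i) (\<xi> i x) - W pi x * indicator (A i) (\<xi> i x)) / 2)"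
    by (simp only: Re left_diff_distrib times_divide_eq_left)
  also have "(LINT x|M. Im (?F x *\<^sub>R iexp (g x))) =
     (LINT x|M. W (- pi / 2) x * indicator (A i) (\<xi> i x) - (W 0 x * indicator (A i) (\<xi> i x)) / 2 - (W pi x * indicator (A i) (\<xi> i x)) / 2)"
    by (simp only: Im left_diff_distrib times_divide_eq_left)
  finally show "cylinder_char M (insert i J) A I u \<xi> =
      Complex (((LINT x|M. W 0 x * indicator (A i) (\<xi> i x)) - (LINT x|M. W pi x * indicator (A i) (\<xi> i x))) / 2)
              ((LINT x|M. W (- pi / 2) x * indicator (A i) (\<xi> i x)) -
               (LINT x|M. W 0 x * indicator (A i) (\<xi> i x)) / 2 - (LINT x|M. W pi x * indicator (A i) (\<xi> i x)) / 2)"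
    by (simp add: intW)
qed

text \<open>Induction on \<open>J\<close> with \<open>J \<union> I\<close> held fixed: each step
  moves one coordinate from the exponent into an indicator. \<open>I\<close> and \<open>u\<close>
  are generalised because the step calls the hypothesis with a larger \<open>I\<close> and with
  exponents \<open>0\<close>, \<open>u\<close> and \<open>- u\<close>, each with an arbitrary value
  at \<open>i\<close>.\<close>

lemma cylinder_char_unique:
  fixes \<xi> :: "'i \<Rightarrow> 'a \<Rightarrow> real" and \<eta> :: "'i \<Rightarrow> 'b \<Rightarrow> real"
  assumes M: "prob_space M" and N: "prob_space N" and J: "finite J" and I: "finite I" "I \<inter> J = {}"
    and \<xi>: "\<And>k. k \<in> J \<union> I \<Longrightarrow> \<xi> k \<in> borel_measurable M"
    and \<eta>: "\<And>k. k \<in> J \<union> I \<Longrightarrow> \<eta> k \<in> borel_measurable N"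
    and A: "\<And>k. k \<in> J \<Longrightarrow> A k \<in> sets borel"
    and eq: "\<And>u. cylinder_char M {} A (J \<union> I) u \<xi> = cylinder_char N {} A (J \<union> I) u \<eta>"
  shows "cylinder_char M J A I u \<xi> = cylinder_char N J A I u \<eta>"
  using J I \<xi> \<eta> A eq
proof (induction J arbitrary: I u rule: finite_induct)
  case (insert i J)
  have IH: "cylinder_char M J A (insert i I) u \<xi> = cylinder_char N J A (insert i I) u \<eta>" for u
    using insert.hyps insert.prems by (intro insert.IH) auto
  have i: "i \<notin> I" using insert.prems by auto
  note SM = cylinder_char_step[OF M \<open>finite J\<close> \<open>finite I\<close> i, of \<xi> A]
  note SN = cylinder_char_step[OF N \<open>finite J\<close> \<open>finite I\<close> i, of \<eta> A]
  note P = insert.prems(3,4,5)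
  \<comment> \<open>For fixed \<open>\<theta>\<close> this compares the weighted laws of
    \<open>\<xi> i\<close> and \<open>\<eta> i\<close>; their transforms are combinations of values
    that \<open>IH\<close> identifies.\<close>
  have *: "(LINT x|M. ((\<Prod>k\<in>J. indicator (A k) (\<xi> k x)) * (1 + cos ((\<Sum>k\<in>I. u k * \<xi> k x) + \<theta>))) * indicator (A i) (\<xi> i x))
     = (LINT x|N. ((\<Prod>k\<in>J. indicator (A k) (\<eta> k x)) * (1 + cos ((\<Sum>k\<in>I. u k * \<eta> k x) + \<theta>))) * indicator (A i) (\<eta> i x))" for \<theta>
  proof (rule weighted_char_uniqueness)
    show "(LINT x|M. ((\<Prod>k\<in>J. indicator (A k) (\<xi> k x)) * (1 + cos ((\<Sum>k\<in>I. u k * \<xi> k x) + \<theta>))) *\<^sub>R iexp (t * \<xi> i x))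
      = (LINT x|N. ((\<Prod>k\<in>J. indicator (A k) (\<eta> k x)) * (1 + cos ((\<Sum>k\<in>I. u k * \<eta> k x) + \<theta>))) *\<^sub>R iexp (t * \<eta> i x))" for t
      by (subst SM(3) SN(3), use P in \<open>auto; fail\<close>, use P in \<open>auto; fail\<close>)+ (simp only: IH)
  qed (use SM(1,2) SN(1,2) P in auto)
  show ?case
    by (subst SM(4) SN(4), use P in \<open>auto; fail\<close>, use P in \<open>auto; fail\<close>, rule \<open>i \<notin> J\<close>)+ (simp only: *)
qed simp

text \<open>Once all coordinates are indicators, the cylinder transform is the probability of a
  rectangle. The two families may live on different probability spaces, which permits comparing a
  joint law with a product of laws.\<close>

lemma char_uniqueness_rectangles:
  fixes \<xi> :: "'i \<Rightarrow> 'a \<Rightarrow> real" and \<eta> :: "'i \<Rightarrow> 'b \<Rightarrow> real"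
  assumes M: "prob_space M" and N: "prob_space N" and J: "finite J"
    and \<xi>: "\<And>k. k \<in> J \<Longrightarrow> \<xi> k \<in> borel_measurable M"
    and \<eta>: "\<And>k. k \<in> J \<Longrightarrow> \<eta> k \<in> borel_measurable N"
    and A: "\<And>k. k \<in> J \<Longrightarrow> A k \<in> sets borel"
    and eq: "\<And>u. (LINT x|M. iexp (\<Sum>k\<in>J. u k * \<xi> k x)) = (LINT y|N. iexp (\<Sum>k\<in>J. u k * \<eta> k y))"
  shows "measure M {x \<in> space M. \<forall>k\<in>J. \<xi> k x \<in> A k} = measure N {y \<in> space N. \<forall>k\<in>J. \<eta> k y \<in> A k}"
proof -
  have *: "cylinder_char P J A {} u \<zeta> = measure P {x \<in> space P. \<forall>k\<in>J. \<zeta> k x \<in> A k}"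
    for P :: "'c measure" and \<zeta> u
  proof -
    have "cylinder_char P J A {} u \<zeta> = (LINT x|P. complex_of_real (indicator {x \<in> space P. \<forall>k\<in>J. \<zeta> k x \<in> A k} x))"
      unfolding cylinder_char_def using J
      by (intro Bochner_Integration.integral_cong) (auto simp: indicator_def prod_zero_iff scaleR_conv_of_real)
    also have "\<dots> = complex_of_real (LINT x|P. indicator {x \<in> space P. \<forall>k\<in>J. \<zeta> k x \<in> A k} x)"
      by (simp only: integral_complex_of_real)
    also have "\<dots> = measure P ({x \<in> space P. \<forall>k\<in>J. \<zeta> k x \<in> A k} \<inter> space P)"
      by simp
    also have "{x \<in> space P. \<forall>k\<in>J. \<zeta> k x \<in> A k} \<inter> space P = {x \<in> space P. \<forall>k\<in>J. \<zeta> k x \<in> A k}"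
      by auto
    finally show ?thesis .
  qed
  have "cylinder_char M J A {} (\<lambda>_. 0) \<xi> = cylinder_char N J A {} (\<lambda>_. 0) \<eta>"
    by (rule cylinder_char_unique[OF M N J]) (use \<xi> \<eta> A eq in \<open>auto simp: cylinder_char_def\<close>)
  then show ?thesis by (simp only: * of_real_eq_iff)
qed

subsection \<open>Finiteness of the distance covariance\<close>

lemma K_const_pos: "K_const q > 0"
  unfolding K_const_def by (intro divide_pos_pos Gamma_real_pos) auto

text \<open>Discriminant argument: the expectation of \<open>(t * f x - g x)\<^sup>2\<close> is a
  quadratic in \<open>t\<close> that is never negative, evaluated at its minimiser
  \<open>c / a\<close>.\<close>

lemma Cauchy_Schwarz_expectation:
  fixes f g :: "'a \<Rightarrow> real"
  assumes [simp]: "integrable M (\<lambda>x. (f x)\<^sup>2)" "integrable M (\<lambda>x. (g x)\<^sup>2)" "integrable M (\<lambda>x. f x * g x)"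
  shows "(LINT x|M. f x * g x)\<^sup>2 \<le> (LINT x|M. (f x)\<^sup>2) * (LINT x|M. (g x)\<^sup>2)"
proof -
  define a b c where "a = (LINT x|M. (f x)\<^sup>2)" and "b = (LINT x|M. (g x)\<^sup>2)" and "c = (LINT x|M. f x * g x)"
  have q: "0 \<le> t\<^sup>2 * a - 2 * t * c + b" for t
  proof -
    have "0 \<le> (LINT x|M. (t * f x - g x)\<^sup>2)" by simp
    also have "\<dots> = (LINT x|M. t\<^sup>2 * (f x)\<^sup>2 - 2 * t * (f x * g x) + (g x)\<^sup>2)"
      by (intro Bochner_Integration.integral_cong) (auto simp: power2_diff algebra_simps power_mult_distrib)
    also have "\<dots> = t\<^sup>2 * a - 2 * t * c + b"
      by (simp add: a_def b_def c_def)
    finally show ?thesis .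
  qed
  have "a \<ge> 0" by (simp add: a_def)
  show ?thesis unfolding a_def[symmetric] b_def[symmetric] c_def[symmetric]
  proof (cases "a = 0")
    case True
    have "c = 0"
    proof (rule ccontr)
      assume "c \<noteq> 0"
      \<comment> \<open>With \<open>a = 0\<close> the form is linear in \<open>t\<close>, and the
        first value of \<open>t\<close> makes it \<open>-1\<close>.\<close>
      then show False using q[of "(b + 1) / (2 * c)"] q[of 0] True by simp
    qed
    then show "c\<^sup>2 \<le> a * b" using True by simp
  next
    case False
    with \<open>a \<ge> 0\<close> have "a > 0" by simp
    then show "c\<^sup>2 \<le> a * b" using q[of "c / a"]
      by (simp add: power2_eq_square field_simps)
  qed
qed

text \<open>Combines the Lipschitz bound \<open>\<bar>t\<bar>\<close>, which gives decay at the
  origin, with the trivial bound 2; the factor 4 is the square of the latter.\<close>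

lemma cmod_iexp_minus_1_le: "(cmod (iexp t - 1))\<^sup>2 \<le> 4 * min 1 (t\<^sup>2)"
proof -
  have "cmod (iexp t - 1) \<le> \<bar>t\<bar>"
    using iexp_approx1[of t 0] by simp
  then have 1: "(cmod (iexp t - 1))\<^sup>2 \<le> t\<^sup>2"
    using power_mono[of _ "\<bar>t\<bar>" 2] by fastforce
  have "cmod (iexp t - 1) \<le> 2"
    using norm_triangle_ineq4[of "iexp t" 1] by simp
  then have "(cmod (iexp t - 1))\<^sup>2 \<le> 2\<^sup>2"
    by (intro power_mono) auto
  moreover have "x \<le> 4 * min 1 s" if "x \<le> s" "x \<le> 2\<^sup>2" "0 \<le> s" for x s :: real
    using that by (auto simp: min_def)
  ultimately show ?thesis using 1 by simp
qed

text \<open>Shifting both exponentials by 1 leaves the covariance unchanged but makes each factor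
  small near frequency zero. The constant is \<open>4 * 4 * 4\<close>: one 4 from
  \<open>(x + y)\<^sup>2 \<le> 2 * x\<^sup>2 + 2 * y\<^sup>2\<close> with Cauchy-Schwarz on both
  terms, and one more for each factor from \<open>cmod_iexp_minus_1_le\<close>.\<close>

lemma char_fun_diff_le:
  fixes Y :: "'w \<Rightarrow> 'i \<Rightarrow> real" and Z :: "'w \<Rightarrow> 'j \<Rightarrow> real"
  assumes "prob_space M"
    and Y[measurable]: "Y \<in> measurable M (lebesgue_on_index I)"
    and Z[measurable]: "Z \<in> measurable M (lebesgue_on_index J)"
    and u: "u \<in> space (lebesgue_on_index I)" and v: "v \<in> space (lebesgue_on_index J)"
  shows "(cmod (joint_char_fun M I Y J Z u v - char_fun M I Y u * char_fun M J Z v))\<^sup>2 \<le>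
    64 * ((LINT w|M. min 1 ((L2_set (Y w) I * L2_set u I)\<^sup>2)) * (LINT w|M. min 1 ((L2_set (Z w) J * L2_set v J)\<^sup>2)))"
proof -
  interpret prob_space M by fact
  define s where "s w = inner_on I u (Y w)" for w
  define t where "t w = inner_on J v (Z w)" for w
  have [measurable]: "s \<in> borel_measurable M" "t \<in> borel_measurable M"
    unfolding s_def t_def using u v by measurable
  define F where "F w = iexp (s w) - 1" for w
  define G where "G w = iexp (t w) - 1" for w
  have [measurable]: "F \<in> borel_measurable M" "G \<in> borel_measurable M"
    unfolding F_def G_def by measurable
  have FG: "cmod (F w) \<le> 2" "cmod (G w) \<le> 2" for w
    unfolding F_def G_def using norm_triangle_ineq4[of "iexp (s w)" 1] norm_triangle_ineq4[of "iexp (t w)" 1] by auto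
  have iexp[simp]: "integrable M (\<lambda>w. iexp (h w))" if [measurable]: "h \<in> borel_measurable M" for h
    by (rule integrable_const_bound[of _ 1]) auto
  have prod2: "cmod (F w) * cmod (G w) \<le> 2 * 2" for w using FG[of w] by (intro mult_mono) auto
  have sq2: "(cmod (F w))\<^sup>2 \<le> 2\<^sup>2" "(cmod (G w))\<^sup>2 \<le> 2\<^sup>2" for w by (simp_all only: power_mono FG norm_ge_zero)
  have int[simp]: "integrable M (\<lambda>w. F w * G w)"
    "integrable M (\<lambda>w. (cmod (F w))\<^sup>2)" "integrable M (\<lambda>w. (cmod (G w))\<^sup>2)" "integrable M (\<lambda>w. cmod (F w) * cmod (G w))"
    using FG prod2 sq2 by (auto intro!: integrable_const_bound[of _ 4] simp: norm_mult)
  have [simp]: "integrable M F" "integrable M G"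
    using FG by (auto intro!: integrable_const_bound[of _ 2])
  have "joint_char_fun M I Y J Z u v = (LINT w|M. F w * G w + iexp (s w) + iexp (t w) - 1)"
    unfolding joint_char_fun_def
    by (intro Bochner_Integration.integral_cong) (auto simp: F_def G_def s_def t_def exp_add algebra_simps)
  also have "\<dots> = (LINT w|M. F w * G w) + (LINT w|M. iexp (s w)) + (LINT w|M. iexp (t w)) - 1"
    by (simp add: prob_space)
  finally have "joint_char_fun M I Y J Z u v - char_fun M I Y u * char_fun M J Z v =
     (LINT w|M. F w * G w) - ((LINT w|M. iexp (s w)) - 1) * ((LINT w|M. iexp (t w)) - 1)"
    by (simp add: char_fun_def s_def t_def algebra_simps)
  also have "\<dots> = (LINT w|M. F w * G w) - (LINT w|M. F w) * (LINT w|M. G w)"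
    unfolding F_def G_def by (simp add: prob_space)
  also have "cmod \<dots> \<le> cmod (LINT w|M. F w * G w) + cmod (LINT w|M. F w) * cmod (LINT w|M. G w)"
    by (metis norm_mult norm_triangle_ineq4)
  also have "\<dots> \<le> (LINT w|M. cmod (F w) * cmod (G w)) + (LINT w|M. cmod (F w)) * (LINT w|M. cmod (G w))"
    using integral_norm_bound[of M "\<lambda>w. F w * G w"] integral_norm_bound[of M F] integral_norm_bound[of M G]
    by (intro add_mono mult_mono) (auto simp: norm_mult)
  finally have "(cmod (joint_char_fun M I Y J Z u v - char_fun M I Y u * char_fun M J Z v))\<^sup>2 \<le>
     ((LINT w|M. cmod (F w) * cmod (G w)) + (LINT w|M. cmod (F w)) * (LINT w|M. cmod (G w)))\<^sup>2"
    by (intro power_mono) auto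
  also have "\<dots> \<le> 2 * (LINT w|M. cmod (F w) * cmod (G w))\<^sup>2 + 2 * ((LINT w|M. cmod (F w))\<^sup>2 * (LINT w|M. cmod (G w))\<^sup>2)"
    using sum_squares_bound[of "LINT w|M. cmod (F w) * cmod (G w)" "(LINT w|M. cmod (F w)) * (LINT w|M. cmod (G w))"]
    by (simp add: power2_sum power_mult_distrib)
  also have "\<dots> \<le> 2 * ((LINT w|M. (cmod (F w))\<^sup>2) * (LINT w|M. (cmod (G w))\<^sup>2)) + 2 * ((LINT w|M. (cmod (F w))\<^sup>2) * (LINT w|M. (cmod (G w))\<^sup>2))"
  proof (intro add_mono mult_left_mono mult_mono)
    show "(LINT w|M. cmod (F w) * cmod (G w))\<^sup>2 \<le> (LINT w|M. (cmod (F w))\<^sup>2) * (LINT w|M. (cmod (G w))\<^sup>2)"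
      by (rule Cauchy_Schwarz_expectation) simp_all
    show "(LINT w|M. cmod (F w))\<^sup>2 \<le> (LINT w|M. (cmod (F w))\<^sup>2)"
      using Cauchy_Schwarz_expectation[of M "\<lambda>w. cmod (F w)" "\<lambda>_. 1"] by (simp add: prob_space)
    show "(LINT w|M. cmod (G w))\<^sup>2 \<le> (LINT w|M. (cmod (G w))\<^sup>2)"
      using Cauchy_Schwarz_expectation[of M "\<lambda>w. cmod (G w)" "\<lambda>_. 1"] by (simp add: prob_space)
  qed auto
  also have "\<dots> = 4 * ((LINT w|M. (cmod (F w))\<^sup>2) * (LINT w|M. (cmod (G w))\<^sup>2))" by simp
  also have "\<dots> \<le> 4 * ((4 * (LINT w|M. min 1 ((L2_set (Y w) I * L2_set u I)\<^sup>2))) * (4 * (LINT w|M. min 1 ((L2_set (Z w) J * L2_set v J)\<^sup>2))))"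
  proof (intro mult_left_mono mult_mono)
    have sq: "h\<^sup>2 \<le> (a * b)\<^sup>2" if "\<bar>h\<bar> \<le> b * a" for h a b :: real
      using power_mono[OF that, of 2] by (simp add: mult.commute)
    have bnd: "integrable M (\<lambda>w. 4 * min 1 ((h w)\<^sup>2))" if [measurable]: "h \<in> borel_measurable M" for h :: "'w \<Rightarrow> real"
      by (intro integrable_mult_right integrable_const_bound[of _ 1]) auto
    have "(cmod (F w))\<^sup>2 \<le> 4 * min 1 ((L2_set (Y w) I * L2_set u I)\<^sup>2)" for w
      using cmod_iexp_minus_1_le[of "s w"] sq[OF abs_inner_on_le[of I u "Y w"]] unfolding F_def s_def by linarith
    then have "(LINT w|M. (cmod (F w))\<^sup>2) \<le> (LINT w|M. 4 * min 1 ((L2_set (Y w) I * L2_set u I)\<^sup>2))"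
      by (intro integral_mono bnd int) measurable
    then show "(LINT w|M. (cmod (F w))\<^sup>2) \<le> 4 * (LINT w|M. min 1 ((L2_set (Y w) I * L2_set u I)\<^sup>2))" by simp
    have "(cmod (G w))\<^sup>2 \<le> 4 * min 1 ((L2_set (Z w) J * L2_set v J)\<^sup>2)" for w
      using cmod_iexp_minus_1_le[of "t w"] sq[OF abs_inner_on_le[of J v "Z w"]] unfolding G_def t_def by linarith
    then have "(LINT w|M. (cmod (G w))\<^sup>2) \<le> (LINT w|M. 4 * min 1 ((L2_set (Z w) J * L2_set v J)\<^sup>2))"
      by (intro integral_mono bnd int) measurable
    then show "(LINT w|M. (cmod (G w))\<^sup>2) \<le> 4 * (LINT w|M. min 1 ((L2_set (Z w) J * L2_set v J)\<^sup>2))" by simp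
  qed auto
  finally show ?thesis by simp
qed

text \<open>Tonelli moves the \<open>u\<close>-integral inside the expectation, where the radial
  estimate with \<open>r = L2_set (Y w) I\<close> leaves a multiple of the first moment.\<close>

lemma radial_expectation_finite:
  fixes Y :: "'w \<Rightarrow> 'i \<Rightarrow> real"
  assumes "prob_space M" "finite I"
    and Y[measurable]: "Y \<in> measurable M (lebesgue_on_index I)"
    and int: "integrable M (\<lambda>w. L2_set (Y w) I)"
  shows "(\<integral>\<^sup>+u. ennreal ((LINT w|M. min 1 ((L2_set (Y w) I * L2_set u I)\<^sup>2)) * inverse (L2_set u I ^ (card I + 1))) \<partial>lebesgue_on_index I) < \<infinity>"
proof -
  interpret prob_space M by fact
  interpret L: sigma_finite_measure "lebesgue_on_index I" by (rule sigma_finite_lebesgue_on_index) fact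
  interpret P: pair_sigma_finite "lebesgue_on_index I" M ..
  have "ennreal ((LINT w|M. min 1 ((L2_set (Y w) I * L2_set u I)\<^sup>2)) * inverse (L2_set u I ^ (card I + 1)))
     = (\<integral>\<^sup>+w. ennreal (min 1 ((L2_set (Y w) I * L2_set u I)\<^sup>2) * inverse (L2_set u I ^ (card I + 1))) \<partial>M)"
    if "u \<in> space (lebesgue_on_index I)" for u
    by (subst nn_integral_eq_integral) (auto intro!: integrable_mult_left integrable_const_bound[of _ 1])
  then have "(\<integral>\<^sup>+u. ennreal ((LINT w|M. min 1 ((L2_set (Y w) I * L2_set u I)\<^sup>2)) * inverse (L2_set u I ^ (card I + 1))) \<partial>lebesgue_on_index I)
    = (\<integral>\<^sup>+u. \<integral>\<^sup>+w. ennreal (min 1 ((L2_set (Y w) I * L2_set u I)\<^sup>2) * inverse (L2_set u I ^ (card I + 1))) \<partial>M \<partial>lebesgue_on_index I)"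
    by (rule nn_integral_cong)
  also have "\<dots> = (\<integral>\<^sup>+w. \<integral>\<^sup>+u. ennreal (min 1 ((L2_set (Y w) I * L2_set u I)\<^sup>2) * inverse (L2_set u I ^ (card I + 1))) \<partial>lebesgue_on_index I \<partial>M)"
    by (rule P.Fubini'[symmetric]) measurable
  also have "\<dots> \<le> (\<integral>\<^sup>+w. ennreal (10 * 4 ^ card I * L2_set (Y w) I) \<partial>M)"
    by (intro nn_integral_mono radial_integral_le \<open>finite I\<close>) simp
  also have "\<dots> = ennreal (LINT w|M. 10 * 4 ^ card I * L2_set (Y w) I)"
    using int by (intro nn_integral_eq_integral) auto
  also have "\<dots> < \<infinity>" by simp
  finally show ?thesis .
qed

text \<open>Once the weight is split, the pointwise bound is a function of \<open>u\<close> times a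
  function of \<open>v\<close>, so the double integral is at most a product of two finite
  integrals.\<close>

lemma dcov_sq_finite:
  fixes Y :: "'w \<Rightarrow> 'i \<Rightarrow> real" and Z :: "'w \<Rightarrow> 'j \<Rightarrow> real"
  assumes "prob_space M" "finite I" "finite J"
    and Y[measurable]: "Y \<in> measurable M (lebesgue_on_index I)"
    and Z[measurable]: "Z \<in> measurable M (lebesgue_on_index J)"
    and intY: "integrable M (\<lambda>w. L2_set (Y w) I)" and intZ: "integrable M (\<lambda>w. L2_set (Z w) J)"
  shows "dcov_sq M I Y J Z < \<infinity>"
proof -
  interpret prob_space M by fact
  interpret LJ: sigma_finite_measure "lebesgue_on_index J" by (rule sigma_finite_lebesgue_on_index) fact
  let ?I = "lebesgue_on_index I" and ?J = "lebesgue_on_index J"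
  define a where "a u = (LINT w|M. min 1 ((L2_set (Y w) I * L2_set u I)\<^sup>2)) * inverse (L2_set u I ^ (card I + 1))" for u
  define b where "b v = (LINT w|M. min 1 ((L2_set (Z w) J * L2_set v J)\<^sup>2)) * inverse (L2_set v J ^ (card J + 1))" for v
  define c where "c = 64 * inverse (K_const (card I) * K_const (card J))"
  have [measurable]: "a \<in> borel_measurable ?I" "b \<in> borel_measurable ?J"
    unfolding a_def b_def by measurable
  have nonneg: "a u \<ge> 0" "b v \<ge> 0" "c \<ge> 0" for u v
    using K_const_pos[of "card I"] K_const_pos[of "card J"] by (auto simp: a_def b_def c_def intro!: mult_nonneg_nonneg)
  have bound: "(cmod (joint_char_fun M I Y J Z u v - char_fun M I Y u * char_fun M J Z v))\<^sup>2 * weight I J u v \<le> c * (a u * b v)"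
    if "u \<in> space ?I" "v \<in> space ?J" for u v
  proof -
    have "weight I J u v \<ge> 0"
      using K_const_pos[of "card I"] K_const_pos[of "card J"] by (auto simp: weight_def)
    then have "(cmod (joint_char_fun M I Y J Z u v - char_fun M I Y u * char_fun M J Z v))\<^sup>2 * weight I J u v \<le>
      64 * ((LINT w|M. min 1 ((L2_set (Y w) I * L2_set u I)\<^sup>2)) * (LINT w|M. min 1 ((L2_set (Z w) J * L2_set v J)\<^sup>2))) * weight I J u v"
      by (intro mult_right_mono char_fun_diff_le assms that)
    also have "\<dots> = c * (a u * b v)"
      by (simp add: weight_def c_def a_def b_def)
    finally show ?thesis .
  qed
  have "dcov_sq M I Y J Z \<le> (\<integral>\<^sup>+(u, v). ennreal c * (ennreal (a u) * ennreal (b v)) \<partial>(?I \<Otimes>\<^sub>M ?J))"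
    unfolding dcov_sq_def using nonneg bound
    by (intro nn_integral_mono) (auto simp: space_pair_measure simp flip: ennreal_mult intro!: ennreal_leI)
  also have "\<dots> = ennreal c * (\<integral>\<^sup>+u. ennreal (a u) \<partial>?I) * (\<integral>\<^sup>+v. ennreal (b v) \<partial>?J)"
    by (simp add: LJ.nn_integral_fst[symmetric] nn_integral_cmult nn_integral_multc mult.assoc)
  also have "\<dots> < \<infinity>"
    using radial_expectation_finite[OF \<open>prob_space M\<close> \<open>finite I\<close> Y intY] radial_expectation_finite[OF \<open>prob_space M\<close> \<open>finite J\<close> Z intZ]
    unfolding a_def[symmetric] b_def[symmetric] by (simp add: ennreal_mult_less_top)
  finally show ?thesis .
qed

subsection \<open>Vanishing distance covariance and independence\<close>

lemma integral_iexp_pair: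
  assumes "prob_space P" "prob_space Q"
    and [measurable]: "f \<in> borel_measurable P" "g \<in> borel_measurable Q"
  shows "(LINT z|(P \<Otimes>\<^sub>M Q). iexp (f (fst z) + g (snd z))) = (LINT x|P. iexp (f x)) * (LINT y|Q. iexp (g y))"
proof -
  interpret P: prob_space P by fact
  interpret Q: prob_space Q by fact
  interpret PQ: pair_prob_space P Q ..
  have "(LINT z|(P \<Otimes>\<^sub>M Q). iexp (f (fst z) + g (snd z))) = (LINT x|P. LINT y|Q. iexp (f x + g y))"
    by (subst PQ.integral_fst'[symmetric]) (auto intro!: PQ.integrable_const_bound[of _ 1])
  also have "\<dots> = (LINT x|P. LINT y|Q. iexp (f x) * iexp (g y))"
    by (simp add: exp_add distrib_left)
  also have "\<dots> = (LINT x|P. iexp (f x) * (LINT y|Q. iexp (g y)))"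
    by (simp only: integral_mult_right_zero)
  also have "\<dots> = (LINT x|P. iexp (f x)) * (LINT y|Q. iexp (g y))"
    by (simp only: integral_mult_left_zero)
  finally show ?thesis .
qed

lemma joint_char_fun_eq_distr:
  assumes Y[measurable]: "Y \<in> measurable M (lebesgue_on_index I)"
    and Z[measurable]: "Z \<in> measurable M (lebesgue_on_index J)"
    and u: "u \<in> space (lebesgue_on_index I)" and v: "v \<in> space (lebesgue_on_index J)"
  shows "joint_char_fun M I Y J Z u v =
    (LINT z|distr M (lebesgue_on_index I \<Otimes>\<^sub>M lebesgue_on_index J) (\<lambda>w. (Y w, Z w)). iexp (inner_on I u (fst z) + inner_on J v (snd z)))"
  unfolding joint_char_fun_def using u v
  by (subst integral_distr) measurable

lemma char_fun_eq_distr: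
  assumes Y[measurable]: "Y \<in> measurable M (lebesgue_on_index I)"
    and u: "u \<in> space (lebesgue_on_index I)"
  shows "char_fun M I Y u = (LINT y|distr M (lebesgue_on_index I) Y. iexp (inner_on I u y))"
  unfolding char_fun_def using u
  by (subst integral_distr) measurable

text \<open>Turns factorisation of the joint characteristic function into equality of the transforms
  of the joint law and the product of the marginals. Both implications between independence and
  vanishing use this form.\<close>

lemma char_fun_product_eq:
  assumes "prob_space M"
    and Y[measurable]: "Y \<in> measurable M (lebesgue_on_index I)"
    and Z[measurable]: "Z \<in> measurable M (lebesgue_on_index J)"
    and u: "u \<in> space (lebesgue_on_index I)" and v: "v \<in> space (lebesgue_on_index J)"
  shows "char_fun M I Y u * char_fun M J Z v =
    (LINT z|(distr M (lebesgue_on_index I) Y \<Otimes>\<^sub>M distr M (lebesgue_on_index J) Z). iexp (inner_on I u (fst z) + inner_on J v (snd z)))"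
proof -
  interpret prob_space M by fact
  have "prob_space (distr M (lebesgue_on_index I) Y)" "prob_space (distr M (lebesgue_on_index J) Z)"
    by (auto intro: prob_space_distr)
  from integral_iexp_pair[OF this, of "inner_on I u" "inner_on J v"] show ?thesis
    using u v by (simp add: char_fun_eq_distr)
qed

text \<open>
  The library's \<open>indep_var\<close> forces both variables to have the same value type, which fails for
  \<open>X\<^sub>c\<close> (indexed by \<open>nat\<close>) and a subvector (indexed by pairs).
\<close>

definition indep_pair ::
  "'w measure \<Rightarrow> 'a measure \<Rightarrow> ('w \<Rightarrow> 'a) \<Rightarrow> 'b measure \<Rightarrow> ('w \<Rightarrow> 'b) \<Rightarrow> bool" where
  "indep_pair M S Y T Z \<longleftrightarrow> (\<forall>A\<in>sets S. \<forall>B\<in>sets T.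
    measure M (Y -` A \<inter> space M \<inter> (Z -` B \<inter> space M)) = measure M (Y -` A \<inter> space M) * measure M (Z -` B \<inter> space M))"

text \<open>Preimages of intersection-stable generators are again intersection-stable, and the
  sigma-algebras they generate are exactly the preimages of \<open>sets S\<close> and
  \<open>sets T\<close>; independence extends by \<open>indep_set_sigma_sets\<close>.\<close>

lemma indep_pair_generators:
  assumes "prob_space M" and Y: "Y \<in> measurable M S" and Z: "Z \<in> measurable M T"
    and E: "sets S = sigma_sets (space S) E" "Int_stable E" and F: "sets T = sigma_sets (space T) F" "Int_stable F"
    and indep: "\<And>A B. A \<in> E \<Longrightarrow> B \<in> F \<Longrightarrow>
      measure M (Y -` A \<inter> space M \<inter> (Z -` B \<inter> space M)) = measure M (Y -` A \<inter> space M) * measure M (Z -` B \<inter> space M)"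
  shows "indep_pair M S Y T Z"
proof -
  interpret prob_space M by fact
  have stable: "Int_stable {X -` A \<inter> space M | A. A \<in> G}" if "Int_stable G" for X :: "'a \<Rightarrow> 'd" and G
  proof (rule Int_stableI)
    fix a b assume "a \<in> {X -` A \<inter> space M | A. A \<in> G}" "b \<in> {X -` A \<inter> space M | A. A \<in> G}"
    then obtain A B where "A \<in> G" "B \<in> G" "a = X -` A \<inter> space M" "b = X -` B \<inter> space M" by auto
    then show "a \<inter> b \<in> {X -` A \<inter> space M | A. A \<in> G}"
      using that by (auto simp: Int_stable_def intro!: exI[of _ "A \<inter> B"])
  qed
  have "indep_set {Y -` A \<inter> space M | A. A \<in> E} {Z -` B \<inter> space M | B. B \<in> F}"
    using indep E F by (intro indep_setI) (auto intro!: measurable_sets[OF Y] measurable_sets[OF Z])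
  then have "indep_set (sigma_sets (space M) {Y -` A \<inter> space M | A. A \<in> E}) (sigma_sets (space M) {Z -` B \<inter> space M | B. B \<in> F})"
    using E F by (intro indep_set_sigma_sets stable)
  moreover have "sigma_sets (space M) {Y -` A \<inter> space M | A. A \<in> E} = {Y -` A \<inter> space M | A. A \<in> sets S}"
    unfolding E(1) using measurable_space[OF Y] by (intro sigma_sets_vimage_commute[symmetric]) auto
  moreover have "sigma_sets (space M) {Z -` B \<inter> space M | B. B \<in> F} = {Z -` B \<inter> space M | B. B \<in> sets T}"
    unfolding F(1) using measurable_space[OF Z] by (intro sigma_sets_vimage_commute[symmetric]) auto
  ultimately show ?thesis
    unfolding indep_pair_def by (auto dest!: indep_setD)
qed

text \<open>\<open>indep_pair\<close> is the product formula on measurable rectangles, and these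
  determine the product of sigma-finite measures.\<close>

lemma indep_pair_distr_eq:
  assumes "prob_space M" and [measurable]: "Y \<in> measurable M S" "Z \<in> measurable M T"
    and indep: "indep_pair M S Y T Z"
  shows "distr M S Y \<Otimes>\<^sub>M distr M T Z = distr M (S \<Otimes>\<^sub>M T) (\<lambda>w. (Y w, Z w))"
proof -
  interpret prob_space M by fact
  interpret P: prob_space "distr M S Y" by (rule prob_space_distr) simp
  interpret Q: prob_space "distr M T Z" by (rule prob_space_distr) simp
  show ?thesis
  proof (rule pair_measure_eqI)
    fix A B assume AB: "A \<in> sets (distr M S Y)" "B \<in> sets (distr M T Z)"
    have "emeasure (distr M (S \<Otimes>\<^sub>M T) (\<lambda>w. (Y w, Z w))) (A \<times> B) = emeasure M ((\<lambda>w. (Y w, Z w)) -` (A \<times> B) \<inter> space M)"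
      using AB by (subst emeasure_distr) auto
    also have "(\<lambda>w. (Y w, Z w)) -` (A \<times> B) \<inter> space M = Y -` A \<inter> space M \<inter> (Z -` B \<inter> space M)"
      by auto
    also have "emeasure M \<dots> = emeasure M (Y -` A \<inter> space M) * emeasure M (Z -` B \<inter> space M)"
      using indep AB by (simp add: indep_pair_def emeasure_eq_measure ennreal_mult)
    finally show "emeasure (distr M S Y) A * emeasure (distr M T Z) B = emeasure (distr M (S \<Otimes>\<^sub>M T) (\<lambda>w. (Y w, Z w))) (A \<times> B)"
      using AB by (simp add: emeasure_distr)
  qed (auto intro: P.sigma_finite_measure_axioms Q.sigma_finite_measure_axioms)
qed

lemma dcov_sq_eq_0_if_indep_pair:
  assumes "prob_space M"
    and Y: "Y \<in> measurable M (lebesgue_on_index I)" and Z: "Z \<in> measurable M (lebesgue_on_index J)"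
    and indep: "indep_pair M (lebesgue_on_index I) Y (lebesgue_on_index J) Z"
  shows "dcov_sq M I Y J Z = 0"
proof -
  note eq = indep_pair_distr_eq[OF \<open>prob_space M\<close> Y Z indep]
  have "dcov_sq M I Y J Z = (\<integral>\<^sup>+ z. 0 \<partial>(lebesgue_on_index I \<Otimes>\<^sub>M lebesgue_on_index J))"
    unfolding dcov_sq_def
  proof (rule nn_integral_cong)
    fix z assume "z \<in> space (lebesgue_on_index I \<Otimes>\<^sub>M lebesgue_on_index J)"
    then obtain u v where z: "z = (u, v)" and uv: "u \<in> space (lebesgue_on_index I)" "v \<in> space (lebesgue_on_index J)"
      by (auto simp: space_pair_measure)
    have "joint_char_fun M I Y J Z u v = char_fun M I Y u * char_fun M J Z v"
      using joint_char_fun_eq_distr[OF Y Z uv] char_fun_product_eq[OF \<open>prob_space M\<close> Y Z uv] eq by simp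
    then show "(case z of (u, v) \<Rightarrow> ennreal ((cmod (joint_char_fun M I Y J Z u v - char_fun M I Y u * char_fun M J Z v))\<^sup>2 * weight I J u v)) = 0"
      by (simp add: z)
  qed
  then show ?thesis by simp
qed

section \<open>From vanishing distance covariance to independence\<close>

text \<open>Dominated convergence with bound 1. Coordinatewise convergence on \<open>I\<close> and
  \<open>J\<close> is enough since \<open>inner_on\<close> reads only these coordinates.\<close>

lemma joint_char_fun_tendsto:
  assumes "prob_space M"
    and Y[measurable]: "Y \<in> measurable M (lebesgue_on_index I)"
    and Z[measurable]: "Z \<in> measurable M (lebesgue_on_index J)"
    and un: "\<And>n. un n \<in> space (lebesgue_on_index I)" and vn: "\<And>n. vn n \<in> space (lebesgue_on_index J)"
    and u: "u \<in> space (lebesgue_on_index I)" and v: "v \<in> space (lebesgue_on_index J)"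
    and limu: "\<And>i. i \<in> I \<Longrightarrow> (\<lambda>n. un n i) \<longlonglongrightarrow> u i" and limv: "\<And>j. j \<in> J \<Longrightarrow> (\<lambda>n. vn n j) \<longlonglongrightarrow> v j"
  shows "(\<lambda>n. joint_char_fun M I Y J Z (un n) (vn n)) \<longlonglongrightarrow> joint_char_fun M I Y J Z u v"
proof -
  interpret prob_space M by fact
  show ?thesis
    unfolding joint_char_fun_def
  proof (rule integral_dominated_convergence[where w = "\<lambda>_. 1"])
    have "(\<lambda>n. inner_on I (un n) (Y w) + inner_on J (vn n) (Z w)) \<longlonglongrightarrow> inner_on I u (Y w) + inner_on J v (Z w)" for w
      unfolding inner_on_def using limu limv by (intro tendsto_intros) auto
    then show "AE w in M. (\<lambda>n. iexp (inner_on I (un n) (Y w) + inner_on J (vn n) (Z w))) \<longlonglongrightarrow> iexp (inner_on I u (Y w) + inner_on J v (Z w))"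
      by (intro AE_I2 tendsto_exp tendsto_mult tendsto_const tendsto_of_real)
  qed (use un vn u v in \<open>auto intro!: measurable_inner_on\<close>)
qed

text \<open>The joint statement with a second vector in dimension zero:
  \<open>\<lambda>_. undefined\<close> is the only extensional function on \<open>{}\<close>, and
  its inner product is 0.\<close>

lemma char_fun_tendsto:
  assumes "prob_space M"
    and Y[measurable]: "Y \<in> measurable M (lebesgue_on_index I)"
    and un: "\<And>n. un n \<in> space (lebesgue_on_index I)"
    and u: "u \<in> space (lebesgue_on_index I)"
    and limu: "\<And>i. i \<in> I \<Longrightarrow> (\<lambda>n. un n i) \<longlonglongrightarrow> u i"
  shows "(\<lambda>n. char_fun M I Y (un n)) \<longlonglongrightarrow> char_fun M I Y u"
proof -
  have z: "(\<lambda>_ _. undefined) \<in> measurable M (lebesgue_on_index ({} :: nat set))" "(\<lambda>_. undefined) \<in> space (lebesgue_on_index ({} :: nat set))"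
    by (auto simp: lebesgue_on_index_def space_PiM intro!: measurable_const)
  have "joint_char_fun M I Y ({} :: nat set) (\<lambda>_ _. undefined) u' (\<lambda>_. undefined) = char_fun M I Y u'" for u'
    by (simp add: joint_char_fun_def char_fun_def inner_on_def)
  with joint_char_fun_tendsto[OF \<open>prob_space M\<close> Y z(1) un z(2) u z(2) limu] show ?thesis by simp
qed

text \<open>The closed ball of radius 0 has measure at most \<open>0 ^ card I\<close>, which is 0
  for nonempty \<open>I\<close>. This makes the points where \<open>weight\<close> takes its default
  value negligible.\<close>

lemma AE_L2_set_neq_0:
  assumes "finite I" "I \<noteq> {}"
  shows "AE u in lebesgue_on_index I. L2_set u I \<noteq> 0"
proof (rule AE_I')
  have "emeasure (lebesgue_on_index I) {u \<in> space (lebesgue_on_index I). L2_set u I \<le> 0} \<le> 0"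
    using emeasure_L2_ball_le[OF \<open>finite I\<close>, of 0] assms by (simp add: power_0_left card_gt_0_iff)
  then show "{u \<in> space (lebesgue_on_index I). L2_set u I \<le> 0} \<in> null_sets (lebesgue_on_index I)"
    by (intro null_setsI) auto
qed (auto simp: antisym_conv)

text \<open>The weight is positive off a null set, so a zero integral forces
  \<open>\<Delta> = 0\<close> almost everywhere. Every box around \<open>(u, v)\<close> has positive
  measure and so contains a zero of \<open>\<Delta>\<close>; shrinking boxes and continuity carry
  the zero to \<open>(u, v)\<close>.\<close>

lemma char_fun_factors_if_dcov_sq_eq_0:
  fixes Y :: "'w \<Rightarrow> 'i \<Rightarrow> real" and Z :: "'w \<Rightarrow> 'j \<Rightarrow> real"
  assumes "prob_space M" and I: "finite I" "I \<noteq> {}" and J: "finite J" "J \<noteq> {}"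
    and Y[measurable]: "Y \<in> measurable M (lebesgue_on_index I)"
    and Z[measurable]: "Z \<in> measurable M (lebesgue_on_index J)"
    and zero: "dcov_sq M I Y J Z = 0"
    and u: "u \<in> space (lebesgue_on_index I)" and v: "v \<in> space (lebesgue_on_index J)"
  shows "joint_char_fun M I Y J Z u v = char_fun M I Y u * char_fun M J Z v"
proof -
  interpret prob_space M by fact
  let ?I = "lebesgue_on_index I" and ?J = "lebesgue_on_index J"
  interpret LI: sigma_finite_measure ?I by (rule sigma_finite_lebesgue_on_index) fact
  interpret LJ: sigma_finite_measure ?J by (rule sigma_finite_lebesgue_on_index) fact
  interpret LIJ: pair_sigma_finite ?I ?J ..
  define \<Delta> where "\<Delta> u v = joint_char_fun M I Y J Z u v - char_fun M I Y u * char_fun M J Z v" for u v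
  have [measurable]: "(\<lambda>z. \<Delta> (fst z) (snd z)) \<in> borel_measurable (?I \<Otimes>\<^sub>M ?J)"
    unfolding \<Delta>_def joint_char_fun_def char_fun_def by measurable
  have "AE z in ?I \<Otimes>\<^sub>M ?J. ennreal ((cmod (\<Delta> (fst z) (snd z)))\<^sup>2 * weight I J (fst z) (snd z)) = 0"
  proof (subst nn_integral_0_iff_AE[symmetric])
    show "(\<lambda>z. ennreal ((cmod (\<Delta> (fst z) (snd z)))\<^sup>2 * weight I J (fst z) (snd z))) \<in> borel_measurable (?I \<Otimes>\<^sub>M ?J)"
      unfolding weight_def by measurable
    show "(\<integral>\<^sup>+z. ennreal ((cmod (\<Delta> (fst z) (snd z)))\<^sup>2 * weight I J (fst z) (snd z)) \<partial>(?I \<Otimes>\<^sub>M ?J)) = 0"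
      using zero unfolding dcov_sq_def \<Delta>_def by (simp add: case_prod_beta')
  qed
  \<comment> \<open>Where one norm is zero the weight is 0 by default, so a vanishing integrand says
    nothing about \<open>\<Delta>\<close> there.\<close>
  moreover have "AE z in ?I \<Otimes>\<^sub>M ?J. L2_set (fst z) I \<noteq> 0 \<and> L2_set (snd z) J \<noteq> 0"
  proof (rule LIJ.AE_pair_measure)
    show "AE x in ?I. AE y in ?J. L2_set (fst (x, y)) I \<noteq> 0 \<and> L2_set (snd (x, y)) J \<noteq> 0"
      using AE_L2_set_neq_0[OF I]
    proof eventually_elim
      case (elim x)
      with AE_L2_set_neq_0[OF J] show ?case by auto
    qed
  qed measurable
  ultimately have AE0: "AE z in ?I \<Otimes>\<^sub>M ?J. \<Delta> (fst z) (snd z) = 0"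
  proof eventually_elim
    case (elim z)
    have "L2_set (fst z) I > 0" "L2_set (snd z) J > 0"
      using elim by (simp_all add: order_less_le)
    then have "weight I J (fst z) (snd z) > 0"
      using K_const_pos unfolding weight_def by (intro positive_imp_inverse_positive mult_pos_pos zero_less_power) auto
    with elim show ?case
      by (simp add: ennreal_eq_0_iff mult_le_0_iff not_le)
  qed
  \<comment> \<open>The measure of a box is a product of side lengths \<open>2 * e\<close>, hence
    nonzero; a box without zeros of \<open>\<Delta>\<close> would be null.\<close>
  have box: "\<exists>un vn. un \<in> space ?I \<and> vn \<in> space ?J \<and> \<Delta> un vn = 0 \<and> (\<forall>i\<in>I. \<bar>un i - u i\<bar> \<le> e) \<and> (\<forall>j\<in>J. \<bar>vn j - v j\<bar> \<le> e)"
    if "e > 0" for e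
  proof (rule ccontr)
    assume neg: "\<not> ?thesis"
    define A where "A = Pi\<^sub>E I (\<lambda>i. {u i - e .. u i + e})"
    define B where "B = Pi\<^sub>E J (\<lambda>j. {v j - e .. v j + e})"
    have A: "A \<in> sets ?I" and B: "B \<in> sets ?J"
      unfolding A_def B_def using I J by (auto intro!: PiE_in_sets_lebesgue_on_index)
    have "AE z in ?I \<Otimes>\<^sub>M ?J. z \<notin> A \<times> B"
      using AE0
    proof eventually_elim
      case (elim z)
      show ?case
      proof
        assume "z \<in> A \<times> B"
        then obtain x y where z: "z = (x, y)" "x \<in> A" "y \<in> B" by auto
        have "x \<in> space ?I" "y \<in> space ?J"
          using z A B by (auto dest: sets.sets_into_space)
        moreover have "\<forall>i\<in>I. \<bar>x i - u i\<bar> \<le> e" "\<forall>j\<in>J. \<bar>y j - v j\<bar> \<le> e"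
          using z unfolding A_def B_def by (auto dest!: PiE_mem simp: abs_le_iff)
        moreover have "\<Delta> x y = 0" using elim z by simp
        ultimately show False using neg by blast
      qed
    qed
    then have "emeasure (?I \<Otimes>\<^sub>M ?J) (A \<times> B) = 0"
      using AE_iff_null_sets[of "A \<times> B" "?I \<Otimes>\<^sub>M ?J"] A B by (auto dest: null_setsD1)
    moreover have "emeasure (?I \<Otimes>\<^sub>M ?J) (A \<times> B) = emeasure ?I A * emeasure ?J B"
      by (rule LJ.emeasure_pair_measure_Times[OF A B])
    moreover have "emeasure ?I A \<noteq> 0" "emeasure ?J B \<noteq> 0"
      unfolding A_def B_def using I J \<open>e > 0\<close> by (auto simp: emeasure_lebesgue_on_index_PiE)
    ultimately show False by simp
  qed
  have "\<forall>n. \<exists>un vn. un \<in> space ?I \<and> vn \<in> space ?J \<and> \<Delta> un vn = 0 \<and>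
    (\<forall>i\<in>I. \<bar>un i - u i\<bar> \<le> 1 / real (Suc n)) \<and> (\<forall>j\<in>J. \<bar>vn j - v j\<bar> \<le> 1 / real (Suc n))"
    by (intro allI box) simp
  then obtain un vn where un: "\<And>n. un n \<in> space ?I" and vn: "\<And>n. vn n \<in> space ?J" and \<Delta>0: "\<And>n. \<Delta> (un n) (vn n) = 0"
    and un_lim: "\<And>n i. i \<in> I \<Longrightarrow> \<bar>un n i - u i\<bar> \<le> 1 / real (Suc n)"
    and vn_lim: "\<And>n j. j \<in> J \<Longrightarrow> \<bar>vn n j - v j\<bar> \<le> 1 / real (Suc n)"
    by metis
  have lim: "x \<longlonglongrightarrow> l" if "\<And>n. \<bar>x n - l\<bar> \<le> 1 / real (Suc n)" for x :: "nat \<Rightarrow> real" and l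
    using that by (intro LIM_zero_cancel[OF tendsto_rabs_zero_cancel[OF tendsto_sandwich[OF _ _ tendsto_const LIMSEQ_inverse_real_of_nat]]])
       (auto simp: inverse_eq_divide)
  have "(\<lambda>n. \<Delta> (un n) (vn n)) \<longlonglongrightarrow> \<Delta> u v"
    unfolding \<Delta>_def
    by (intro tendsto_intros joint_char_fun_tendsto char_fun_tendsto assms un vn lim un_lim vn_lim)
  then have "\<Delta> u v = 0"
    unfolding \<Delta>0 by (simp add: LIMSEQ_const_iff)
  then show ?thesis by (simp add: \<Delta>_def)
qed

text \<open>By factorisation, the joint vector on \<open>M\<close> and the coordinates on the
  product of the marginal laws have equal transforms. Uniqueness then gives the product formula on
  rectangles, an intersection-stable generator.\<close>

lemma indep_pair_if_dcov_sq_eq_0: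
  fixes Y :: "'w \<Rightarrow> 'i \<Rightarrow> real" and Z :: "'w \<Rightarrow> 'j \<Rightarrow> real"
  assumes "prob_space M" and I: "finite I" "I \<noteq> {}" and J: "finite J" "J \<noteq> {}"
    and Y[measurable]: "Y \<in> measurable M (lebesgue_on_index I)"
    and Z[measurable]: "Z \<in> measurable M (lebesgue_on_index J)"
    and zero: "dcov_sq M I Y J Z = 0"
  shows "indep_pair M (lebesgue_on_index I) Y (lebesgue_on_index J) Z"
proof -
  interpret prob_space M by fact
  let ?I = "lebesgue_on_index I" and ?J = "lebesgue_on_index J"
  let ?P = "distr M ?I Y" and ?Q = "distr M ?J Z"
  interpret P: prob_space ?P by (rule prob_space_distr) simp
  interpret Q: prob_space ?Q by (rule prob_space_distr) simp
  interpret PQ: pair_prob_space ?P ?Q ..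
  \<comment> \<open>The coordinates of both vectors are merged over the sum type, as the two index
    types may differ.\<close>
  define \<xi> where "\<xi> k w = (case k of Inl i \<Rightarrow> Y w i | Inr j \<Rightarrow> Z w j)" for k w
  define \<eta> where "\<eta> k z = (case k of Inl i \<Rightarrow> fst z i | Inr j \<Rightarrow> snd z j)" for k and z :: "('i \<Rightarrow> real) \<times> ('j \<Rightarrow> real)"
  have rect: "prob {w \<in> space M. (\<forall>i\<in>I. Y w i \<in> A i) \<and> (\<forall>j\<in>J. Z w j \<in> B j)} =
      prob {w \<in> space M. \<forall>i\<in>I. Y w i \<in> A i} * prob {w \<in> space M. \<forall>j\<in>J. Z w j \<in> B j}"
    if A: "\<And>i. i \<in> I \<Longrightarrow> A i \<in> sets borel" and B: "\<And>j. j \<in> J \<Longrightarrow> B j \<in> sets borel" for A B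
  proof -
    define C where "C k = (case k of Inl i \<Rightarrow> A i | Inr j \<Rightarrow> B j)" for k
    have SA: "{y \<in> space ?I. \<forall>i\<in>I. y i \<in> A i} \<in> sets ?I" and SB: "{z \<in> space ?J. \<forall>j\<in>J. z j \<in> B j} \<in> sets ?J"
      using A B I J by measurable
    have "prob {w \<in> space M. \<forall>k\<in>I <+> J. \<xi> k w \<in> C k} = measure (?P \<Otimes>\<^sub>M ?Q) {z \<in> space (?P \<Otimes>\<^sub>M ?Q). \<forall>k\<in>I <+> J. \<eta> k z \<in> C k}"
    proof (rule char_uniqueness_rectangles)
      show "prob_space M" "prob_space (?P \<Otimes>\<^sub>M ?Q)" "finite (I <+> J)"
        using I J by (auto intro: prob_space_axioms PQ.prob_space_axioms)
      show "\<xi> k \<in> borel_measurable M" if "k \<in> I <+> J" for k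
        using that by (auto simp: \<xi>_def[abs_def])
      show "\<eta> k \<in> borel_measurable (?P \<Otimes>\<^sub>M ?Q)" if "k \<in> I <+> J" for k
        using that by (auto simp: \<eta>_def[abs_def])
      show "C k \<in> sets borel" if "k \<in> I <+> J" for k
        using that A B by (auto simp: C_def)
      fix u :: "'i + 'j \<Rightarrow> real"
      \<comment> \<open>Restriction makes the frequencies extensional, hence points of the index
        spaces, without changing the inner products.\<close>
      let ?u = "\<lambda>i\<in>I. u (Inl i)" and ?v = "\<lambda>j\<in>J. u (Inr j)"
      have uv: "?u \<in> space ?I" "?v \<in> space ?J"
        by (auto simp: space_lebesgue_on_index)
      have sum: "(\<Sum>k\<in>I <+> J. h k) = (\<Sum>i\<in>I. h (Inl i)) + (\<Sum>j\<in>J. h (Inr j))" for h :: "'i + 'j \<Rightarrow> real"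
        using I J by (simp add: sum.Plus comp_def)
      have "(LINT w|M. iexp (\<Sum>k\<in>I <+> J. u k * \<xi> k w)) = joint_char_fun M I Y J Z ?u ?v"
        unfolding sum joint_char_fun_def by (simp add: \<xi>_def inner_on_def)
      also have "\<dots> = char_fun M I Y ?u * char_fun M J Z ?v"
        by (intro char_fun_factors_if_dcov_sq_eq_0 assms uv)
      also have "\<dots> = (LINT z|(?P \<Otimes>\<^sub>M ?Q). iexp (inner_on I ?u (fst z) + inner_on J ?v (snd z)))"
        by (intro char_fun_product_eq assms uv)
      also have "\<dots> = (LINT z|(?P \<Otimes>\<^sub>M ?Q). iexp (\<Sum>k\<in>I <+> J. u k * \<eta> k z))"
        unfolding sum by (simp add: \<eta>_def inner_on_def)
      finally show "(LINT w|M. iexp (\<Sum>k\<in>I <+> J. u k * \<xi> k w)) = (LINT z|(?P \<Otimes>\<^sub>M ?Q). iexp (\<Sum>k\<in>I <+> J. u k * \<eta> k z))" .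
    qed
    also have "{z \<in> space (?P \<Otimes>\<^sub>M ?Q). \<forall>k\<in>I <+> J. \<eta> k z \<in> C k} =
       {y \<in> space ?I. \<forall>i\<in>I. y i \<in> A i} \<times> {z \<in> space ?J. \<forall>j\<in>J. z j \<in> B j}"
      by (auto simp: \<eta>_def C_def space_pair_measure ball_Un Plus_def)
    also have "measure (?P \<Otimes>\<^sub>M ?Q) \<dots> = measure ?P {y \<in> space ?I. \<forall>i\<in>I. y i \<in> A i} * measure ?Q {z \<in> space ?J. \<forall>j\<in>J. z j \<in> B j}"
      using SA SB by (simp add: measure_def Q.emeasure_pair_measure_Times enn2real_mult)
    also have "\<dots> = prob (Y -` {y \<in> space ?I. \<forall>i\<in>I. y i \<in> A i} \<inter> space M) * prob (Z -` {z \<in> space ?J. \<forall>j\<in>J. z j \<in> B j} \<inter> space M)"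
      using SA SB by (simp add: measure_distr)
    also have "Y -` {y \<in> space ?I. \<forall>i\<in>I. y i \<in> A i} \<inter> space M = {w \<in> space M. \<forall>i\<in>I. Y w i \<in> A i}"
      using measurable_space[OF Y] by auto
    also have "Z -` {z \<in> space ?J. \<forall>j\<in>J. z j \<in> B j} \<inter> space M = {w \<in> space M. \<forall>j\<in>J. Z w j \<in> B j}"
      using measurable_space[OF Z] by auto
    also have "{w \<in> space M. \<forall>k\<in>I <+> J. \<xi> k w \<in> C k} = {w \<in> space M. (\<forall>i\<in>I. Y w i \<in> A i) \<and> (\<forall>j\<in>J. Z w j \<in> B j)}"
      by (auto simp: \<xi>_def C_def Plus_def ball_Un)
    finally show ?thesis .
  qed
show ?thesis
  proof (rule indep_pair_generators)
    show "sets ?I = sigma_sets (space ?I) (prod_algebra I (\<lambda>_. lborel))" "sets ?J = sigma_sets (space ?J) (prod_algebra J (\<lambda>_. lborel))"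
      by (simp_all add: lebesgue_on_index_def sets_PiM space_PiM)
    fix a b assume "a \<in> prod_algebra I (\<lambda>_. lborel :: real measure)" "b \<in> prod_algebra J (\<lambda>_. lborel :: real measure)"
    then obtain A B where a: "a = Pi\<^sub>E I A" and A: "\<And>i. i \<in> I \<Longrightarrow> A i \<in> sets borel"
      and b: "b = Pi\<^sub>E J B" and B: "\<And>j. j \<in> J \<Longrightarrow> B j \<in> sets borel"
      by (elim prod_algebraE_all) (auto simp: Pi_iff)
    \<comment> \<open>Membership in a box includes extensionality; the values of \<open>Y\<close>
      and \<open>Z\<close> have it, so only the coordinate conditions remain.\<close>
    have ext: "Y w \<in> extensional I" "Z w \<in> extensional J" if "w \<in> space M" for w
      using that measurable_space[OF Y] measurable_space[OF Z] by (auto simp: space_lebesgue_on_index)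
    have "Y -` a \<inter> space M = {w \<in> space M. \<forall>i\<in>I. Y w i \<in> A i}" "Z -` b \<inter> space M = {w \<in> space M. \<forall>j\<in>J. Z w j \<in> B j}"
      using ext by (auto simp: a b PiE_def Pi_iff)
    moreover have "{w \<in> space M. \<forall>i\<in>I. Y w i \<in> A i} \<inter> {w \<in> space M. \<forall>j\<in>J. Z w j \<in> B j} = {w \<in> space M. (\<forall>i\<in>I. Y w i \<in> A i) \<and> (\<forall>j\<in>J. Z w j \<in> B j)}"
      by auto
    ultimately show "prob (Y -` a \<inter> space M \<inter> (Z -` b \<inter> space M)) = prob (Y -` a \<inter> space M) * prob (Z -` b \<inter> space M)"
      using rect[OF A B] by simp
  qed (simp_all add: Int_stable_prod_algebra assms)
qed

subsection \<open>Subvectors and mutual independence\<close>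

lemma measurable_subvector:
  assumes X: "\<And>j. j \<in> A \<Longrightarrow> X j \<in> measurable M (lebesgue_on_index {1..p j})"
  shows "subvector p X A \<in> measurable M (lebesgue_on_index (coords p A))"
  unfolding subvector_def lebesgue_on_index_def
proof (rule measurable_restrict)
  fix i assume "i \<in> coords p A"
  then show "(\<lambda>w. case i of (j, k) \<Rightarrow> X j w k) \<in> measurable M lborel"
    by (auto simp: coords_def intro!: measurable_lebesgue_on_index_component X)
qed

lemma finite_coords: "finite A \<Longrightarrow> finite (coords p A)"
  by (simp add: coords_def)

lemma coords_nonempty: "j \<in> A \<Longrightarrow> 1 \<le> p j \<Longrightarrow> coords p A \<noteq> {}"
  by (force simp: coords_def)

lemma L2_set_subvector: "finite A \<Longrightarrow> L2_set (subvector p X A w) (coords p A) = sqrt (\<Sum>j\<in>A. \<Sum>k=1..p j. (X j w k)\<^sup>2)"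
  unfolding L2_set_def coords_def subvector_def by (simp add: sum.Sigma case_prod_beta cong: sum.cong)

text \<open>Passing to fewer blocks drops nonnegative terms under the square root, so the norm of
  the larger vector dominates.\<close>

lemma integrable_L2_set_subvector:
  assumes X: "\<And>j. j \<in> B \<Longrightarrow> X j \<in> measurable M (lebesgue_on_index {1..p j})" and B: "finite B"
    and int: "integrable M (\<lambda>w. L2_set (subvector p X B w) (coords p B))"
    and A: "A \<subseteq> B"
  shows "integrable M (\<lambda>w. L2_set (subvector p X A w) (coords p A))"
proof (rule Bochner_Integration.integrable_bound[OF int])
  show "(\<lambda>w. L2_set (subvector p X A w) (coords p A)) \<in> borel_measurable M"
    using X A by (intro measurable_L2_set measurable_subvector) auto
  show "AE w in M. norm (L2_set (subvector p X A w) (coords p A)) \<le> norm (L2_set (subvector p X B w) (coords p B))"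
    using A B finite_subset[OF A B] by (auto simp: L2_set_subvector sum_nonneg intro!: sum_mono2)
qed

text \<open>Transfers the moment of a one-block subvector, indexed by pairs, to \<open>X c\<close>,
  indexed by \<open>nat\<close>.\<close>

lemma L2_set_singleton_subvector: "L2_set (subvector p X {c} w) (coords p {c}) = L2_set (X c w) {1..p c}"
  unfolding L2_set_subvector[OF finite.insertI[OF finite.emptyI]] by (simp add: L2_set_def)

section \<open>Mutual independence versus independence of blocks\<close>

text \<open>Disjoint groups of independent vectors are independent as groups; \<open>X c\<close> and
  the subvector are measurable images of the groups \<open>{c}\<close> and \<open>B\<close>.\<close>

lemma indep_pair_if_indep_vars:
  assumes "prob_space M"
    and indep: "prob_space.indep_vars M (\<lambda>j. lebesgue_on_index {1..p j}) X I"
    and c: "c \<in> I" and B: "B \<subseteq> I" "c \<notin> B"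
  shows "indep_pair M (lebesgue_on_index {1..p c}) (X c) (lebesgue_on_index (coords p B)) (subvector p X B)"
  unfolding indep_pair_def
proof (intro ballI)
  interpret prob_space M by fact
  let ?L = "\<lambda>j. lebesgue_on_index {1..p j}"
  fix S T assume S: "S \<in> sets (?L c)" and T: "T \<in> sets (lebesgue_on_index (coords p B))"
  have X: "X j \<in> measurable M (?L j)" if "j \<in> I" for j
    using indep that by (auto simp: indep_vars_def)
  \<comment> \<open>Both groups take values in
    \<open>nat \<Rightarrow> nat \<Rightarrow> real\<close>, so \<open>indep_var\<close> applies to
    them; \<open>g\<close> below flattens a family into a subvector.\<close>
  have iv: "indep_var (PiM {c} ?L) (\<lambda>w. restrict (\<lambda>j. X j w) {c}) (PiM B ?L) (\<lambda>w. restrict (\<lambda>j. X j w) B)"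
    using indep B c by (intro indep_var_restrict) auto
  define g where "g y = (\<lambda>(j, k)\<in>coords p B. y j k)" for y :: "nat \<Rightarrow> nat \<Rightarrow> real"
  have f: "(\<lambda>y. y c) \<in> measurable (PiM {c} ?L) (?L c)"
    by (rule measurable_component_singleton) simp
  have g: "g \<in> measurable (PiM B ?L) (lebesgue_on_index (coords p B))"
    unfolding g_def lebesgue_on_index_def[of "coords p B"]
  proof (rule measurable_restrict)
    fix i assume "i \<in> coords p B"
    then obtain j k where "i = (j, k)" "j \<in> B" "k \<in> {1..p j}" by (auto simp: coords_def)
    then show "(\<lambda>y. case i of (j, k) \<Rightarrow> y j k) \<in> measurable (PiM B ?L) lborel"
      by (auto intro!: measurable_lebesgue_on_index_component[where I = "{1..p j}"] measurable_component_singleton)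
  qed
  have sub: "g (\<lambda>j\<in>B. X j w) = subvector p X B w" for w
    unfolding g_def subvector_def by (auto simp: fun_eq_iff restrict_def coords_def)
  have "prob ((\<lambda>w. (\<lambda>j\<in>{c}. X j w, \<lambda>j\<in>B. X j w)) -` (((\<lambda>y. y c) -` S \<inter> space (PiM {c} ?L)) \<times> (g -` T \<inter> space (PiM B ?L))) \<inter> space M) =
    prob ((\<lambda>w. \<lambda>j\<in>{c}. X j w) -` ((\<lambda>y. y c) -` S \<inter> space (PiM {c} ?L)) \<inter> space M) * prob ((\<lambda>w. \<lambda>j\<in>B. X j w) -` (g -` T \<inter> space (PiM B ?L)) \<inter> space M)"
    by (intro indep_varD[OF iv] measurable_sets[OF f S] measurable_sets[OF g T])
  moreover have "(\<lambda>w. \<lambda>j\<in>{c}. X j w) -` ((\<lambda>y. y c) -` S \<inter> space (PiM {c} ?L)) \<inter> space M = X c -` S \<inter> space M"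
    using measurable_space[OF X] c by (auto simp: space_PiM)
  moreover have "(\<lambda>w. \<lambda>j\<in>B. X j w) -` (g -` T \<inter> space (PiM B ?L)) \<inter> space M = subvector p X B -` T \<inter> space M"
    using measurable_space[OF X[OF subsetD[OF B(1)]]] by (auto simp: space_PiM sub)
  moreover have "(\<lambda>w. (\<lambda>j\<in>{c}. X j w, \<lambda>j\<in>B. X j w)) -` (((\<lambda>y. y c) -` S \<inter> space (PiM {c} ?L)) \<times> (g -` T \<inter> space (PiM B ?L))) \<inter> space M =
    ((\<lambda>w. \<lambda>j\<in>{c}. X j w) -` ((\<lambda>y. y c) -` S \<inter> space (PiM {c} ?L)) \<inter> space M) \<inter> ((\<lambda>w. \<lambda>j\<in>B. X j w) -` (g -` T \<inter> space (PiM B ?L)) \<inter> space M)"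
    by auto
  ultimately show "prob (X c -` S \<inter> space M \<inter> (subvector p X B -` T \<inter> space M)) = prob (X c -` S \<inter> space M) * prob (subvector p X B -` T \<inter> space M)"
    by simp
qed

text \<open>The product formula for the tail \<open>{c..d}\<close> is proved downwards from
  \<open>c = d\<close>: each step splits off \<open>X c\<close>, the rest of the event being a
  preimage under the subvector of \<open>B c\<close>. Asking only that \<open>B c\<close> contain
  the tail lets it be the tail itself or the complement of \<open>{c}\<close>.\<close>

lemma indep_vars_if_indep_pairs:
  fixes X :: "nat \<Rightarrow> 'w \<Rightarrow> nat \<Rightarrow> real"
  assumes "prob_space M" and d: "d \<ge> 1"
    and X: "\<And>j. j \<in> {1..d} \<Longrightarrow> X j \<in> measurable M (lebesgue_on_index {1..p j})"
    and B: "\<And>c. c \<in> {1..<d} \<Longrightarrow> {c + 1..d} \<subseteq> B c"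
    and indep: "\<And>c. c \<in> {1..<d} \<Longrightarrow>
      indep_pair M (lebesgue_on_index {1..p c}) (X c) (lebesgue_on_index (coords p (B c))) (subvector p X (B c))"
  shows "prob_space.indep_vars M (\<lambda>j. lebesgue_on_index {1..p j}) X {1..d}"
proof -
  interpret prob_space M by fact
  let ?L = "\<lambda>j. lebesgue_on_index {1..p j}"
  have tail: "prob (\<Inter>j\<in>{c..d}. X j -` A j \<inter> space M) = (\<Prod>j=c..d. prob (X j -` A j \<inter> space M))"
    if A: "\<And>j. j \<in> {1..d} \<Longrightarrow> A j \<in> sets (?L j)" and "c \<le> d" "1 \<le> c" for A c
    using \<open>c \<le> d\<close> \<open>1 \<le> c\<close>
  proof (induction c rule: inc_induct)
    case base
    then show ?case by simp
  next
    case (step c)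
    then have c: "c \<in> {1..<d}" by auto
    \<comment> \<open>The cylinder over the tail: each block \<open>j > c\<close> is read back from
      the flattened vector, and the other blocks of \<open>B c\<close> stay free.\<close>
    define T where "T = {y \<in> space (lebesgue_on_index (coords p (B c))). \<forall>j\<in>{c + 1..d}. (\<lambda>k\<in>{1..p j}. y (j, k)) \<in> A j}"
    have "(\<lambda>y. \<lambda>k\<in>{1..p j}. y (j, k)) \<in> measurable (lebesgue_on_index (coords p (B c))) (?L j)" if "j \<in> {c + 1..d}" for j
      unfolding lebesgue_on_index_def[of "{1..p j}"]
    proof (rule measurable_restrict)
      fix k assume "k \<in> {1..p j}"
      then show "(\<lambda>y. y (j, k)) \<in> measurable (lebesgue_on_index (coords p (B c))) lborel"
        using that B[OF c] by (auto simp: coords_def intro!: measurable_lebesgue_on_index_component[where I = "coords p (B c)"])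
    qed
    then have "{y \<in> space (lebesgue_on_index (coords p (B c))). (\<lambda>k\<in>{1..p j}. y (j, k)) \<in> A j} \<in> sets (lebesgue_on_index (coords p (B c)))"
      if "j \<in> {c + 1..d}" for j
      using measurable_sets[of _ _ "?L j" "A j"] A[of j] that c by (simp add: vimage_def Int_def conj_commute)
    then have T: "T \<in> sets (lebesgue_on_index (coords p (B c)))"
      unfolding T_def by (intro sets.sets_Collect_finite_All) simp_all
    have sub: "subvector p X (B c) -` T \<inter> space M = (\<Inter>j\<in>{c + 1..d}. X j -` A j \<inter> space M)"
    proof -
      have "subvector p X (B c) w \<in> space (lebesgue_on_index (coords p (B c)))" for w
        by (simp add: subvector_def space_lebesgue_on_index)
      moreover have "(\<lambda>k\<in>{1..p j}. subvector p X (B c) w (j, k)) = X j w" if "w \<in> space M" "j \<in> {c + 1..d}" for w j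
      proof -
        have "X j w \<in> extensional {1..p j}"
          using measurable_space[OF X, of j w] that c by (auto simp: space_lebesgue_on_index)
        moreover have "j \<in> B c" using B[OF c] that by auto
        ultimately show ?thesis
          by (auto simp: fun_eq_iff subvector_def coords_def restrict_def extensional_def)
      qed
      ultimately show ?thesis
        using c unfolding T_def by auto
    qed
    have "{c..d} = insert c {c + 1..d}" using c by auto
    then have "(\<Inter>j\<in>{c..d}. X j -` A j \<inter> space M) = X c -` A c \<inter> space M \<inter> (subvector p X (B c) -` T \<inter> space M)"
      unfolding sub by auto
    then have "prob (\<Inter>j\<in>{c..d}. X j -` A j \<inter> space M) = prob (X c -` A c \<inter> space M) * prob (subvector p X (B c) -` T \<inter> space M)"
      using indep[OF c] A[of c] c T by (simp add: indep_pair_def)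
    also have "prob (subvector p X (B c) -` T \<inter> space M) = (\<Prod>j=c + 1..d. prob (X j -` A j \<inter> space M))"
      unfolding sub using step by simp
    also have "prob (X c -` A c \<inter> space M) * \<dots> = (\<Prod>j=c..d. prob (X j -` A j \<inter> space M))"
      unfolding \<open>{c..d} = insert c {c + 1..d}\<close> by simp
    finally show ?case .
  qed
  show ?thesis
  \<comment> \<open>The full sigma-algebras serve as generators. They contain the whole space, so
    the product formula over all of \<open>{1..d}\<close> also covers subfamilies.\<close>
  proof (subst indep_vars_finite[where E = "\<lambda>j. sets (?L j)"])
    show "\<forall>A\<in>(\<Pi> j\<in>{1..d}. sets (?L j)). prob (\<Inter>j\<in>{1..d}. X j -` A j \<inter> space M) = (\<Prod>j=1..d. prob (X j -` A j \<inter> space M))"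
      using tail[of _ 1] d by (auto simp: Pi_iff)
  qed (use X d in \<open>auto simp: sets.sigma_sets_eq sets.Int_stable dest: sets.sets_into_space\<close>)
qed

section \<open>Finiteness of the two dependence measures and the meaning of their vanishing\<close>

theorem theorem4:
  fixes M :: "'w measure" and d :: nat and p :: "nat \<Rightarrow> nat"
    and X :: "nat \<Rightarrow> 'w \<Rightarrow> nat \<Rightarrow> real"
  assumes "prob_space M"
    and "d \<ge> 2"
    and "\<And>j. j \<in> {1..d} \<Longrightarrow> p j \<ge> 1"
    and "\<And>j. j \<in> {1..d} \<Longrightarrow> X j \<in> measurable M (lebesgue_on_index {1..p j})"
    and "\<And>j. j \<in> {1..d} \<Longrightarrow>
      absolutely_continuous (lebesgue_on_index {1..p j})
        (distr M (lebesgue_on_index {1..p j}) (X j))"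
    and "integrable M (\<lambda>w. L2_set (subvector p X {1..d} w) (coords p {1..d}))"
  shows "R_dep M d p X \<in> {0..<\<infinity>} \<and> S_dep M d p X \<in> {0..<\<infinity>}
    \<and> (R_dep M d p X = 0 \<longleftrightarrow>
        prob_space.indep_vars M (\<lambda>j. lebesgue_on_index {1..p j}) X {1..d})
    \<and> (S_dep M d p X = 0 \<longleftrightarrow>
        prob_space.indep_vars M (\<lambda>j. lebesgue_on_index {1..p j}) X {1..d})"
proof -
  note M = assms(1) and d = assms(2) and p = assms(3) and X = assms(4) and int = assms(6)
  let ?L = "\<lambda>j. lebesgue_on_index {1..p j}"
  let ?dcov = "\<lambda>c B. dcov_sq M {1..p c} (X c) (coords p B) (subvector p X B)"
  have sub: "subvector p X B \<in> measurable M (lebesgue_on_index (coords p B))" if "B \<subseteq> {1..d}" for B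
    using X that by (intro measurable_subvector) auto
  have finite: "?dcov c B < \<infinity>" if c: "c \<in> {1..d}" and B: "B \<subseteq> {1..d}" for c B
  proof (rule dcov_sq_finite[OF M])
    show "integrable M (\<lambda>w. L2_set (X c w) {1..p c})"
      using integrable_L2_set_subvector[OF X _ int, of "{c}"] c by (simp add: L2_set_singleton_subvector)
    show "integrable M (\<lambda>w. L2_set (subvector p X B w) (coords p B))"
      using integrable_L2_set_subvector[OF X _ int B] by simp
  qed (use X sub B c in \<open>auto intro!: finite_coords finite_subset[OF B]\<close>)
  have indep_pair: "indep_pair M (?L c) (X c) (lebesgue_on_index (coords p B)) (subvector p X B)"
    if "?dcov c B = 0" and c: "c \<in> {1..d}" and B: "B \<subseteq> {1..d}" "B \<noteq> {}" for c B
  proof (rule indep_pair_if_dcov_sq_eq_0[OF M _ _ _ _ X sub])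
    show "coords p B \<noteq> {}" using B p coords_nonempty by (metis ex_in_conv subsetD)
    show "{1..p c} \<noteq> {}" using p[OF c] by auto
  qed (use that in \<open>auto intro!: finite_coords finite_subset[OF B(1)]\<close>)
  have zero: "?dcov c B = 0" if "prob_space.indep_vars M ?L X {1..d}" "c \<in> {1..d}" "B \<subseteq> {1..d}" "c \<notin> B" for c B
    using that by (intro dcov_sq_eq_0_if_indep_pair[OF M X sub] indep_pair_if_indep_vars[OF M, of _ _ "{1..d}"]) auto
  \<comment> \<open>One argument serves both sums: \<open>B c\<close> will be the tail after
    \<open>c\<close> for \<open>R_dep\<close> and the complement of \<open>{c}\<close> for
    \<open>S_dep\<close>.\<close>
  have indep: "prob_space.indep_vars M ?L X {1..d}"
    if B: "\<And>c. c \<in> {1..<d} \<Longrightarrow> {c + 1..d} \<subseteq> B c \<and> B c \<subseteq> {1..d} \<and> ?dcov c (B c) = 0" for B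
  proof (rule indep_vars_if_indep_pairs[where B = B, OF M _ X])
    fix c assume c: "c \<in> {1..<d}"
    \<comment> \<open>As \<open>c < d\<close>, the block \<open>d\<close> keeps \<open>B c\<close>
      nonempty, and so \<open>coords p (B c)\<close> is nonempty because all dimensions are at least
      1.\<close>
    then have "d \<in> B c" using B[OF c] by auto
    then show "indep_pair M (?L c) (X c) (lebesgue_on_index (coords p (B c))) (subvector p X (B c))"
      using B[OF c] c by (intro indep_pair) auto
  qed (use B d in auto)
  have "R_dep M d p X < \<infinity>" "S_dep M d p X < \<infinity>"
    unfolding R_dep_def S_dep_def using finite by (auto simp: ennreal_sum_less_top)
  moreover have "R_dep M d p X = 0 \<longleftrightarrow> prob_space.indep_vars M ?L X {1..d}"
  proof
    assume "R_dep M d p X = 0"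
    \<comment> \<open>A finite sum in \<open>ennreal\<close> is zero only when every summand
      is.\<close>
    then show "prob_space.indep_vars M ?L X {1..d}"
      by (intro indep[of "\<lambda>c. {c + 1..d}"]) (auto simp: R_dep_def)
  next
    assume "prob_space.indep_vars M ?L X {1..d}"
    then show "R_dep M d p X = 0"
      unfolding R_dep_def by (intro sum.neutral ballI zero) auto
  qed
  moreover have "S_dep M d p X = 0 \<longleftrightarrow> prob_space.indep_vars M ?L X {1..d}"
  proof
    assume "S_dep M d p X = 0"
    then show "prob_space.indep_vars M ?L X {1..d}"
      by (intro indep[of "\<lambda>c. {1..d} - {c}"]) (auto simp: S_dep_def)
  next
    assume "prob_space.indep_vars M ?L X {1..d}"
    then show "S_dep M d p X = 0"
      unfolding S_dep_def by (intro sum.neutral ballI zero) auto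
  qed
  ultimately show ?thesis by simp
qed

end
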